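(* Let $A_1,\dots,A_n\in\mathbb{P}_m$, let $\omega=(w_1,\dots,w_n)$ be a weight vector with $w_j>0$ for all $j$, and let $\|\cdot\|$ be a strictly increasing unitarily invariant norm on $\mathbb{M}_m$. The following are equivalent: (a) $A_j$ commutes with $LE_\omega(A_1,\dots,A_n)$ for every $j=1,\dots,n$; (b) $G_\omega(A_1^t,\dots,A_n^t)=LE_\omega(A_1^t,\dots,A_n^t)$ for all $t\in\mathbb{R}$; (c) $\|G_\omega(A_1^t,\dots,A_n^t)\|=\|LE_\omega(A_1^t,\dots,A_n^t)\|$ for some $t\ne0$; (d) $\|G_\omega(A_1^t,\dots,A_n^t)^{1/t}\|=\|LE_\omega(A_1,\dots,A_n)\|$ for some $t\ne0$.
   Context: $\mathbb{P}_m$: positive definite $m\times m$ matrices; $A^t$ for real $t$ by functional calculus. The Karcher mean $G_\omega(A_1,\dots,A_n)$ is the unique $X\in\mathbb{P}_m$ with $\sum_j w_j\log(X^{1/2}A_j^{-1}X^{1/2})=0$. The Log-Euclidean mean is $LE_\omega(A_1,\dots,A_n)=\exp(\sum_j w_j\log A_j)$. A norm is unitarily invariant if $\|UXV\|=\|X\|$ for all unitaries $U,V$, and strictly increasing if for positive semidefinite $A\le B$, $\|A\|=\|B\|$ implies $A=B$. *)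

theory Defs
  imports "HOL-Analysis.Analysis"
begin

type_synonym 'm cmat = "complex^'m^'m"

definition adj :: "'m::finite cmat \<Rightarrow> 'm cmat" where
  "adj A = (\<chi> i j. cnj (A $ j $ i))"

definition unitary :: "'m::finite cmat \<Rightarrow> bool" where
  "unitary U \<longleftrightarrow> adj U ** U = mat 1 \<and> U ** adj U = mat 1"

definition hermitian :: "'m::finite cmat \<Rightarrow> bool" where
  "hermitian A \<longleftrightarrow> adj A = A"

definition qform :: "'m::finite cmat \<Rightarrow> complex^'m \<Rightarrow> complex" where
  "qform A x = (\<Sum>i\<in>UNIV. cnj (x $ i) * (A *v x) $ i)"

definition psd :: "'m::finite cmat \<Rightarrow> bool" where
  "psd A \<longleftrightarrow> hermitian A \<and> (\<forall>x. 0 \<le> Re (qform A x))"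

definition pd :: "'m::finite cmat \<Rightarrow> bool" where
  "pd A \<longleftrightarrow> hermitian A \<and> (\<forall>x. x \<noteq> 0 \<longrightarrow> 0 < Re (qform A x))"

definition diagm :: "('m::finite \<Rightarrow> real) \<Rightarrow> 'm cmat" where
  "diagm d = (\<chi> i j. if i = j then complex_of_real (d i) else 0)"

definition hfun :: "(real \<Rightarrow> real) \<Rightarrow> 'm::finite cmat \<Rightarrow> 'm cmat" where
  "hfun f A = (THE X. \<exists>U d. unitary U \<and> A = U ** diagm d ** adj U
                          \<and> X = U ** diagm (f \<circ> d) ** adj U)"

definition mpow :: "'m::finite cmat \<Rightarrow> real \<Rightarrow> 'm cmat" where
  "mpow A t = hfun (\<lambda>x. x powr t) A"

definition mlog :: "'m::finite cmat \<Rightarrow> 'm cmat" where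
  "mlog A = hfun ln A"

definition mexp :: "'m::finite cmat \<Rightarrow> 'm cmat" where
  "mexp A = hfun exp A"

definition LEmean :: "(nat \<Rightarrow> real) \<Rightarrow> nat \<Rightarrow> (nat \<Rightarrow> 'm::finite cmat) \<Rightarrow> 'm cmat" where
  "LEmean w n A = mexp (\<Sum>j<n. (\<chi> a b. complex_of_real (w j) * mlog (A j) $ a $ b))"

definition Karcher :: "(nat \<Rightarrow> real) \<Rightarrow> nat \<Rightarrow> (nat \<Rightarrow> 'm::finite cmat) \<Rightarrow> 'm cmat" where
  "Karcher w n A = (THE X. pd X \<and>
     (\<Sum>j<n. (\<chi> a b. complex_of_real (w j) *
        mlog (mpow X (1/2) ** mpow (A j) (-1) ** mpow X (1/2)) $ a $ b)) = 0)"

definition matrix_norm :: "('m::finite cmat \<Rightarrow> real) \<Rightarrow> bool" where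
  "matrix_norm N \<longleftrightarrow> (\<forall>X. 0 \<le> N X) \<and> (\<forall>X. N X = 0 \<longleftrightarrow> X = 0)
     \<and> (\<forall>c X. N (\<chi> a b. c * X $ a $ b) = cmod c * N X)
     \<and> (\<forall>X Y. N (X + Y) \<le> N X + N Y)"

definition unitarily_invariant :: "('m::finite cmat \<Rightarrow> real) \<Rightarrow> bool" where
  "unitarily_invariant N \<longleftrightarrow> matrix_norm N \<and>
     (\<forall>U V X. unitary U \<longrightarrow> unitary V \<longrightarrow> N (U ** X ** V) = N X)"

definition strictly_increasing :: "('m::finite cmat \<Rightarrow> real) \<Rightarrow> bool" where
  "strictly_increasing N \<longleftrightarrow>
     (\<forall>A B. psd A \<longrightarrow> psd (B - A) \<longrightarrow> N A = N B \<longrightarrow> A = B)"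

end

(* Write X = exp K for the Karcher mean, B_j for the inverse of A_j and H for the weighted sum of
   the log A_j, so that the log-Euclidean mean is exp H. Work in an eigenbasis of K.
   If C is diagonal with entries >= 1 and its i-th entry is 1, then log(C B C)_ii <= log(B)_ii:
   compare the resolvents of B and C B C and integrate. Writing exp(K/2) as a product of such
   matrices, one for each eigenvalue gap of K, and correcting by the trace (which is log det), one
   finds that the sum of log(exp(K/2) B exp(K/2))_ii - log(B)_ii - k_i over any set of top
   eigenvectors of K is nonnegative, and that all these sums vanish only if B commutes with K.
   Summed over j this gives: uniqueness of the Karcher mean (after moving one solution to the
   identity); its existence, by Brouwer, since the Karcher vector field in the coordinate K then
   points inwards on large spheres; and the majorization of the eigenvalues k of K by the diagonal
   h of H. Testing a strictly increasing unitarily invariant norm against a norming functional of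
   exp K, equality of norms forces h = k and H diagonal, so H = K; hence all the sums above vanish
   and every A_j commutes with K. *)
theory Submission
  imports Defs
begin

section \<open>Matrix algebra and unitary matrices\<close>

text \<open>The obstacle is that \<open>diagm d ** B ** diagm d\<close> need not dominate
  \<open>B\<close> even when all entries of \<open>d\<close> are at least 1, so operator
  monotonicity of the logarithm says nothing. What survives is a one-sided bound at the coordinates
  that \<open>d\<close> fixes, and this is why exp(K/2) is cut into factors with two values each. A
  scalar factor changes the logarithm in a known way, which turns the bound at the low coordinates
  into a reverse bound at the high ones. Partial sums are taken in the order of \<open>k\<close>,
  not of \<open>h\<close>. This fits both kinds of weights used later, \<open>k\<close> itself
  (uniqueness, existence) and y_i exp(k_i) for a norming functional y (rigidity): both increase with
  \<open>k\<close>, so Abel summation applies. Strict increase of the norm enters through the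
  positivity of the y_i. The B_j have log mean -H, which is why the weighted gaps at the Karcher
  mean add up to h - k.\<close>

lemma adj_component [simp]: "adj A $ i $ j = cnj (A $ j $ i)"
  by (simp add: adj_def)

lemma adj_adj [simp]: "adj (adj A) = A"
  by (simp add: vec_eq_iff)

lemma adj_mult: "adj (A ** B) = adj B ** adj A"
  by (simp add: vec_eq_iff matrix_matrix_mult_def mult.commute)

lemma adj_add: "adj (A + B) = adj A + adj B"
  by (simp add: vec_eq_iff)

lemma adj_scaleR: "adj (r *\<^sub>R A) = r *\<^sub>R adj A"
  by (simp add: vec_eq_iff)

lemma adj_sum: "adj (\<Sum>j\<in>I. f j) = (\<Sum>j\<in>I. adj (f j))"
  by (simp add: vec_eq_iff)

lemma adj_mat1 [simp]: "adj (mat 1) = mat 1"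
  by (simp add: vec_eq_iff mat_def)

lemma adj_diagm [simp]: "adj (diagm d) = diagm d"
  by (simp add: vec_eq_iff diagm_def)

lemma diagm_component: "diagm d $ i $ j = (if i = j then complex_of_real (d i) else 0)"
  by (simp add: diagm_def)

lemma diagm_mult_left: "(diagm d ** M) $ i $ j = complex_of_real (d i) * M $ i $ j"
proof -
  have "(diagm d ** M) $ i $ j = (\<Sum>k\<in>UNIV. if i = k then complex_of_real (d i) * M $ k $ j else 0)"
    by (simp add: matrix_matrix_mult_def diagm_component if_distrib[of "\<lambda>x. x * _"] cong: if_cong)
  then show ?thesis by simp
qed

lemma diagm_mult_right: "(M ** diagm d) $ i $ j = M $ i $ j * complex_of_real (d j)"
proof -
  have "(M ** diagm d) $ i $ j = (\<Sum>k\<in>UNIV. if k = j then M $ i $ k * complex_of_real (d k) else 0)"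
    by (simp add: matrix_matrix_mult_def diagm_component if_distrib[of "\<lambda>x. _ * x"] cong: if_cong)
  then show ?thesis by simp
qed

lemma diagm_diagm: "diagm a ** diagm b = diagm (\<lambda>i. a i * b i)"
  by (simp add: vec_eq_iff diagm_mult_left) (simp add: diagm_component)

lemma diagm_one: "diagm (\<lambda>_. 1) = mat 1"
  by (simp add: vec_eq_iff diagm_component mat_def)

lemma diagm_add: "diagm a + diagm b = diagm (\<lambda>i. a i + b i)"
  by (simp add: vec_eq_iff diagm_component)

lemma diagm_inject: "diagm a = diagm b \<longleftrightarrow> a = b"
proof
  assume "diagm a = diagm b"
  then have "diagm a $ i $ i = diagm b $ i $ i" for i by simp
  then show "a = b" by (simp add: diagm_component fun_eq_iff)
qed simp

lemma diagm_diff: "diagm a - diagm b = diagm (\<lambda>i. a i - b i)"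
  by (simp add: vec_eq_iff diagm_component)

lemma diagm_scaleR: "r *\<^sub>R diagm a = diagm (\<lambda>i. r * a i)"
  by (simp add: vec_eq_iff diagm_component scaleR_conv_of_real[where 'a=complex])

lemma cmat_scaleR: "(\<chi> a b. complex_of_real r * M $ a $ b) = r *\<^sub>R M"
  by (simp add: vec_eq_iff scaleR_conv_of_real[where 'a=complex])

lemma cmult_scaleR_left: "(r *\<^sub>R A) ** B = r *\<^sub>R (A ** (B::'m::finite cmat))"
  by (simp add: vec_eq_iff matrix_matrix_mult_def scaleR_sum_right)

lemma cmult_scaleR_right: "A ** (r *\<^sub>R B) = r *\<^sub>R (A ** (B::'m::finite cmat))"
  by (simp add: vec_eq_iff matrix_matrix_mult_def scaleR_sum_right)

lemma cmult_sum_left: "(\<Sum>j\<in>I. f j) ** B = (\<Sum>j\<in>I. f j ** (B::'m::finite cmat))"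
  by (simp add: matrix_matrix_mult_def vec_eq_iff sum_distrib_right sum.swap[of _ UNIV I])

lemma cmult_sum_right: "B ** (\<Sum>j\<in>I. f j) = (\<Sum>j\<in>I. (B::'m::finite cmat) ** f j)"
  by (simp add: matrix_matrix_mult_def vec_eq_iff sum_distrib_left sum.swap[of _ UNIV I])

lemma cmult_diff_left: "(A - B) ** C = A ** C - B ** (C::'m::finite cmat)"
  by (simp add: vec_eq_iff matrix_matrix_mult_def left_diff_distrib sum_subtractf)

lemma cmult_diff_right: "C ** (A - B) = C ** A - C ** (B::'m::finite cmat)"
  by (simp add: vec_eq_iff matrix_matrix_mult_def right_diff_distrib sum_subtractf)

lemma cmult_0_left: "0 ** (C::'m::finite cmat) = (0::'m cmat)"
  by (simp add: vec_eq_iff matrix_matrix_mult_def)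

lemma cmult_0_right: "(C::'m::finite cmat) ** (0::'m cmat) = 0"
  by (simp add: vec_eq_iff matrix_matrix_mult_def)

lemma cmv_scaleR: "(A::'m::finite cmat) *v (r *\<^sub>R x) = r *\<^sub>R (A *v x)"
  by (simp add: vec_eq_iff matrix_vector_mult_def scaleR_sum_right)

lemma hermitian_component: "hermitian A \<Longrightarrow> A $ j $ i = cnj (A $ i $ j)"
  by (metis adj_component hermitian_def)

lemma hermitian_diag_real: "hermitian A \<Longrightarrow> A $ i $ i = complex_of_real (Re (A $ i $ i))"
  by (metis hermitian_component Reals_cnj_iff of_real_Re)

lemma hermitian_diagm [simp]: "hermitian (diagm d)"
  by (simp add: hermitian_def)

lemma hermitian_scaleR: "hermitian A \<Longrightarrow> hermitian (r *\<^sub>R A)"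
  by (simp add: hermitian_def adj_scaleR)

lemma hermitian_sum: "(\<And>j. j \<in> I \<Longrightarrow> hermitian (f j)) \<Longrightarrow> hermitian (\<Sum>j\<in>I. f j)"
  by (simp add: hermitian_def adj_sum)

lemma hermitian_congruence: "hermitian A \<Longrightarrow> hermitian (M ** A ** adj M)"
  by (simp add: hermitian_def adj_mult matrix_mul_assoc)

lemma unitary_adj: "unitary U \<Longrightarrow> unitary (adj U)"
  by (auto simp: unitary_def)

lemma unitary_mat1: "unitary (mat 1)"
  by (simp add: unitary_def)

lemma unitaryI: "adj U ** U = mat 1 \<Longrightarrow> unitary U"
  using matrix_left_right_inverse by (auto simp: unitary_def)

lemma unitary_cancel:
  assumes "unitary U"
  shows "adj U ** (U ** M) = M" "U ** (adj U ** M) = M"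
        "M ** adj U ** U = M" "M ** U ** adj U = M"
  using assms
  by (simp_all add: unitary_def matrix_mul_assoc) (simp_all add: matrix_mul_assoc[symmetric])

lemma unitary_mult:
  assumes "unitary U" "unitary V"
  shows "unitary (U ** V)"
proof (rule unitaryI)
  have "adj (U ** V) ** (U ** V) = adj V ** (adj U ** (U ** V))"
    by (simp only: adj_mult matrix_mul_assoc)
  then show "adj (U ** V) ** (U ** V) = mat 1"
    using assms unitary_cancel(1)[of U V] by (simp add: unitary_def)
qed

section \<open>The spectral theorem for commuting Hermitian matrices\<close>

text \<open>\<open>inner\<close> on complex vectors is the real part of this form; the eigenbasis
  must be orthogonal for the full complex form.\<close>

definition cip :: "complex^'m \<Rightarrow> complex^'m::finite \<Rightarrow> complex" where
  "cip x y = (\<Sum>i\<in>UNIV. cnj (x $ i) * y $ i)"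

lemma Re_cip: "Re (cip x y) = inner x y"
  by (simp add: cip_def inner_vec_def inner_complex_def)

lemma cip_commute: "cip y x = cnj (cip x y)"
  by (simp add: cip_def mult.commute)

lemma cip_self: "cip x x = complex_of_real ((norm x)\<^sup>2)"
proof -
  have "Re (cip x x) = (norm x)\<^sup>2" by (simp add: Re_cip power2_norm_eq_inner)
  moreover have "Im (cip x x) = 0" by (simp add: cip_def)
  ultimately show ?thesis by (simp add: complex_eq_iff)
qed

lemma cip_adj: "cip x (A *v y) = cip (adj A *v x) y"
proof -
  have "cip x (A *v y) = (\<Sum>i\<in>UNIV. \<Sum>j\<in>UNIV. cnj (x $ i) * (A $ i $ j * y $ j))"
    by (simp add: cip_def matrix_vector_mult_def sum_distrib_left)
  also have "\<dots> = (\<Sum>j\<in>UNIV. \<Sum>i\<in>UNIV. cnj (x $ i) * (A $ i $ j * y $ j))"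
    by (rule sum.swap)
  also have "\<dots> = cip (adj A *v x) y"
    by (simp add: cip_def matrix_vector_mult_def sum_distrib_right sum_distrib_left mult_ac)
  finally show ?thesis .
qed

lemma inner_adj: "inner x (A *v y) = inner (adj A *v x) (y :: complex^'m::finite)"
  by (metis Re_cip cip_adj)

lemma Re_qform: "Re (qform A x) = inner x (A *v x)"
  by (simp add: qform_def Re_cip[symmetric] cip_def)

text \<open>A maximizer of the quadratic form on the unit sphere of \<open>S\<close> is an
  eigenvector: otherwise moving it against the residual would increase the Rayleigh
  quotient.\<close>

lemma real_eigenvector:
  fixes A :: "'m::finite cmat"
  assumes A: "hermitian A" and S: "subspace S" and inv: "\<And>x. x \<in> S \<Longrightarrow> A *v x \<in> S"
    and ne: "z \<in> S" "z \<noteq> 0"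
  shows "\<exists>x\<in>S. norm x = 1 \<and> (\<exists>l::real. A *v x = l *\<^sub>R x)"
proof -
  have sym: "inner x (A *v y) = inner (A *v x) y" for x y
    using A inner_adj[of x A y] by (simp add: hermitian_def)
  have cont: "continuous_on UNIV (\<lambda>x. A *v x)"
    unfolding matrix_vector_mult_def by (intro continuous_intros)
  let ?K = "S \<inter> sphere 0 1"
  have "compact ?K"
    by (simp add: closed_subspace[OF S] compact_Int_closed Int_commute closed_Int_compact)
  moreover have "(1 / norm z) *\<^sub>R z \<in> ?K"
    using ne S by (auto intro: subspace_scale)
  moreover have "continuous_on ?K (\<lambda>x. inner x (A *v x))"
    by (intro continuous_intros continuous_on_subset[OF cont]) auto
  ultimately obtain x where x: "x \<in> ?K" and mx: "\<And>y. y \<in> ?K \<Longrightarrow> inner y (A *v y) \<le> inner x (A *v x)"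
    using continuous_attains_sup[of ?K "\<lambda>x. inner x (A *v x)"] by blast
  define l where "l = inner x (A *v x)"
  have xx: "inner x x = 1" using x by (simp add: norm_eq_1)
  have le: "inner y (A *v y) \<le> l * inner y y" if "y \<in> S" for y
  proof (cases "y = 0")
    case False
    have "(1 / norm y) *\<^sub>R y \<in> ?K" using that False S by (auto intro: subspace_scale)
    from mx[OF this] have "(1/norm y) * ((1/norm y) * inner y (A *v y)) \<le> l"
      by (simp add: l_def cmv_scaleR)
    then show ?thesis
      using False by (simp add: field_simps power2_norm_eq_inner[symmetric] power2_eq_square)
  qed simp
  \<comment> \<open>\<open>m\<close> is minus half the gradient of the Rayleigh quotient at
    \<open>x\<close>. Moving to x - e m gains a term linear in e against a quadratic one.\<close>
  define m where "m = l *\<^sub>R x - A *v x"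
  have mS: "m \<in> S" using x inv S by (simp add: m_def subspace_diff subspace_scale)
  have main: "2 * e * inner m m \<le> e\<^sup>2 * (l * inner m m - inner m (A *v m))" for e
  proof -
    have "x - e *\<^sub>R m \<in> S" using x mS S by (simp add: subspace_diff subspace_scale)
    then have f1: "inner (x - e *\<^sub>R m) (A *v (x - e *\<^sub>R m)) \<le> l * inner (x - e *\<^sub>R m) (x - e *\<^sub>R m)"
      by (rule le)
    have "inner x (A *v m) = inner m (A *v x)"
      by (metis sym inner_commute)
    then have f2: "inner (x - e *\<^sub>R m) (A *v (x - e *\<^sub>R m))
      = l - 2 * (e * inner m (A *v x)) + e\<^sup>2 * inner m (A *v m)"
      by (simp add: matrix_vector_mult_diff_distrib cmv_scaleR inner_diff_left
        inner_diff_right l_def[symmetric] power2_eq_square right_diff_distrib)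
    have f3: "inner (x - e *\<^sub>R m) (x - e *\<^sub>R m) = 1 - 2 * (e * inner m x) + e\<^sup>2 * inner m m"
      by (simp add: inner_diff_left inner_diff_right xx power2_eq_square inner_commute right_diff_distrib)
    have "inner m m = l * inner m x - inner m (A *v x)"
      using inner_diff_right[of m "l *\<^sub>R x" "A *v x"] by (simp add: m_def[symmetric])
    then have "2 * e * inner m m = 2 * l * (e * inner m x) - 2 * (e * inner m (A *v x))"
      by (simp add: right_diff_distrib)
    then show ?thesis using f1[unfolded f2 f3] by (simp add: algebra_simps)
  qed
  have "inner m m \<le> 0"
  proof (rule ccontr)
    assume "\<not> inner m m \<le> 0"
    then have p: "inner m m > 0" by linarith
    \<comment> \<open>\<open>c\<close> bounds the quadratic coefficient, and the added 1 keeps it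
      positive; \<open>e\<close> is then small enough for the linear term to win.\<close>
    define c where "c = \<bar>l * inner m m - inner m (A *v m)\<bar> + 1"
    have c: "c > 0" by (simp add: c_def)
    define e where "e = inner m m / c"
    have e: "e > 0" using p c by (simp add: e_def)
    have "e\<^sup>2 * (l * inner m m - inner m (A *v m)) \<le> e\<^sup>2 * c"
      by (intro mult_left_mono) (auto simp: c_def)
    also have "\<dots> = e * inner m m" using c by (simp add: e_def power2_eq_square)
    finally show False using main[of e] mult_pos_pos[OF e p] by linarith
  qed
  then have "m = 0" by (metis inner_ge_zero inner_eq_zero_iff order_antisym)
  then have "A *v x = l *\<^sub>R x" by (simp add: m_def)
  then show ?thesis using x by auto
qed

text \<open>Vectors are added one at a time inside the orthogonal complement \<open>S\<close> of
  those found. A common eigenvector takes two applications of \<open>real_eigenvector\<close>: for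
  \<open>A\<close> on \<open>S\<close>, then for \<open>B\<close> on an eigenspace of
  \<open>A\<close> in \<open>S\<close>, which \<open>B\<close> preserves because the matrices
  commute.\<close>

lemma joint_eigenbasis:
  fixes A B :: "'m::finite cmat"
  assumes A: "hermitian A" and B: "hermitian B" and AB: "A ** B = B ** A"
  shows "\<exists>u (a::'m \<Rightarrow> real) (b::'m \<Rightarrow> real). (\<forall>i\<in>T. norm (u i) = 1 \<and> A *v u i = a i *\<^sub>R u i \<and> B *v u i = b i *\<^sub>R u i)
     \<and> (\<forall>i\<in>T. \<forall>j\<in>T. i \<noteq> j \<longrightarrow> cip (u i) (u j) = 0)"
proof (induction T rule: finite_induct[OF finite])
  case 1
  then show ?case by simp
next
  case (2 t T)
  from 2(3) obtain u and a b :: "'m \<Rightarrow> real" where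
    uT: "\<forall>i\<in>T. norm (u i) = 1 \<and> A *v u i = a i *\<^sub>R u i \<and> B *v u i = b i *\<^sub>R u i"
    and ortT: "\<forall>i\<in>T. \<forall>j\<in>T. i \<noteq> j \<longrightarrow> cip (u i) (u j) = 0"
    by (elim exE conjE)
  then have u: "\<And>i. i \<in> T \<Longrightarrow> norm (u i) = 1"
    "\<And>i. i \<in> T \<Longrightarrow> A *v u i = a i *\<^sub>R u i" "\<And>i. i \<in> T \<Longrightarrow> B *v u i = b i *\<^sub>R u i"
    and ort: "\<And>i j. i \<in> T \<Longrightarrow> j \<in> T \<Longrightarrow> i \<noteq> j \<Longrightarrow> cip (u i) (u j) = 0"
    by auto
  define S where "S = {x. \<forall>i\<in>T. cip (u i) x = 0}"
  have S: "subspace S"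
    by (auto simp: subspace_def S_def cip_def sum.distrib distrib_left scaleR_sum_right[symmetric])
  have inv: "M *v x \<in> S" if "hermitian M" "\<And>i. i \<in> T \<Longrightarrow> M *v u i = c i *\<^sub>R u i" "x \<in> S" for M c x
  proof -
    have "cip (u i) (M *v x) = 0" if i: "i \<in> T" for i
    proof -
      have "cip (u i) (M *v x) = cip (c i *\<^sub>R u i) x"
        using that \<open>hermitian M\<close> i \<open>\<And>i. i \<in> T \<Longrightarrow> M *v u i = c i *\<^sub>R u i\<close>
        by (simp add: cip_adj hermitian_def)
      also have "\<dots> = c i *\<^sub>R cip (u i) x"
        by (simp add: cip_def scaleR_sum_right)
      finally show ?thesis using \<open>x \<in> S\<close> i by (simp add: S_def)
    qed
    then show ?thesis by (simp add: S_def)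
  qed
  \<comment> \<open>A real dimension count: complex orthogonality to \<open>u i\<close> is real
    orthogonality to \<open>u i\<close> and to i times \<open>u i\<close>, which gives two real
    conditions per vector.\<close>
  let ?E = "u ` T \<union> (\<lambda>i. \<i> *s u i) ` T"
  have "card ?E \<le> 2 * card T"
    using card_Un_le[of "u ` T" "(\<lambda>i. \<i> *s u i) ` T"] card_image_le[of T u]
      card_image_le[of T "\<lambda>i. \<i> *s u i"] by simp
  moreover have "card T < CARD('m)"
    using 2 by (metis UNIV_I finite psubset_card_mono psubsetI subset_UNIV)
  ultimately have "dim ?E < DIM(complex^'m)"
    using dim_le_card'[of ?E] by simp
  then obtain z where z: "z \<noteq> 0" and zo: "\<And>y. y \<in> span ?E \<Longrightarrow> orthogonal z y"
    using orthogonal_to_subspace_exists[of ?E] by blast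
  have zS: "z \<in> S"
  proof -
    have "cip (u i) z = 0" if "i \<in> T" for i
    proof -
      have "inner z (u i) = 0" "inner z (\<i> *s u i) = 0"
        using zo[of "u i"] zo[of "\<i> *s u i"] that by (auto simp: orthogonal_def span_base)
      moreover have "inner z (\<i> *s u i) = Im (cip (u i) z)"
        by (auto simp: inner_vec_def cip_def inner_complex_def intro!: sum.cong)
      ultimately show ?thesis
        by (simp add: complex_eq_iff Re_cip inner_commute)
    qed
    then show ?thesis by (simp add: S_def)
  qed
  obtain x l where x: "x \<in> S" "norm x = 1" "A *v x = l *\<^sub>R x"
    using real_eigenvector[OF A S inv[OF A u(2)] zS z] by blast
  define S' where "S' = S \<inter> {y. A *v y = l *\<^sub>R y}"
  have S': "subspace S'"
    using S by (simp add: S'_def subspace_def matrix_vector_right_distrib cmv_scaleR scaleR_right_distrib)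
  have inv': "B *v y \<in> S'" if "y \<in> S'" for y
  proof -
    have "A *v (B *v y) = B *v (A *v y)" by (simp only: matrix_vector_mul_assoc AB)
    then show ?thesis using that inv[OF B u(3)] by (simp add: S'_def cmv_scaleR)
  qed
  have "x \<in> S'" "x \<noteq> 0" using x by (auto simp: S'_def)
  then obtain y k where y: "y \<in> S'" "norm y = 1" "B *v y = k *\<^sub>R y"
    using real_eigenvector[OF B S' inv'] by blast
  let ?u = "u(t := y)"
  have "\<forall>i\<in>insert t T. norm (?u i) = 1 \<and> A *v ?u i = (a(t:=l)) i *\<^sub>R ?u i \<and> B *v ?u i = (b(t:=k)) i *\<^sub>R ?u i"
    using u y by (auto simp: S'_def)
  moreover have "\<forall>i\<in>insert t T. \<forall>j\<in>insert t T. i \<noteq> j \<longrightarrow> cip (?u i) (?u j) = 0"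
  proof -
    have "cip (u i) y = 0" "cip y (u i) = 0" if "i \<in> T" for i
      using y that cip_commute[of y "u i"] by (simp_all add: S'_def S_def)
    then show ?thesis using ort 2 by auto
  qed
  ultimately show ?case by blast
qed

theorem joint_spectral:
  fixes A B :: "'m::finite cmat"
  assumes A: "hermitian A" and B: "hermitian B" and AB: "A ** B = B ** A"
  obtains U a b where "unitary U" "A = U ** diagm a ** adj U" "B = U ** diagm b ** adj U"
proof -
  from joint_eigenbasis[OF assms, of UNIV] obtain u and a b :: "'m \<Rightarrow> real" where
    uT: "\<forall>i\<in>UNIV. norm (u i) = 1 \<and> A *v u i = a i *\<^sub>R u i \<and> B *v u i = b i *\<^sub>R u i"
    and ortT: "\<forall>i\<in>UNIV. \<forall>j\<in>UNIV. i \<noteq> j \<longrightarrow> cip (u i) (u j) = 0"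
    by (elim exE conjE)
  then have u: "\<And>i. norm (u i) = 1" "\<And>i. A *v u i = a i *\<^sub>R u i"
      "\<And>i. B *v u i = b i *\<^sub>R u i" "\<And>i j. i \<noteq> j \<Longrightarrow> cip (u i) (u j) = 0"
    by auto
  define U where "U = (\<chi> p i. u i $ p)"
  have "(adj U ** U) $ i $ j = mat 1 $ i $ j" for i j
  proof -
    have "(adj U ** U) $ i $ j = cip (u i) (u j)"
      by (simp add: U_def matrix_matrix_mult_def cip_def)
    then show ?thesis using u(1)[of i] u(4)[of i j] by (auto simp: mat_def cip_self)
  qed
  then have U: "unitary U" by (intro unitaryI) (simp add: vec_eq_iff)
  have diag: "M = U ** diagm c ** adj U" if "\<And>i. M *v u i = c i *\<^sub>R u i" for M and c :: "'m \<Rightarrow> real"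
  proof -
    have "(M ** U) $ p $ i = (U ** diagm c) $ p $ i" for p i
    proof -
      have "(M ** U) $ p $ i = (M *v u i) $ p"
        by (simp add: U_def matrix_matrix_mult_def matrix_vector_mult_def)
      then show ?thesis by (simp add: that diagm_mult_right U_def scaleR_conv_of_real[where 'a=complex])
    qed
    then have "M ** U = U ** diagm c" by (simp add: vec_eq_iff)
    then show ?thesis using unitary_cancel(4)[OF U] by metis
  qed
  show thesis using that U diag u by blast
qed

lemma spectral:
  assumes "hermitian A"
  obtains U a where "unitary U" "A = U ** diagm a ** adj U"
  by (rule joint_spectral[OF assms assms refl]) (rule that)

section \<open>Functional calculus\<close>

text \<open>In the two eigenbases \<open>M\<close> becomes \<open>W\<close>, and the hypothesis says
  that W_ij = 0 unless d_i = e_j, where f(d_i) = f(e_j) as well. With M = 1 this makes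
  \<open>hfun\<close> independent of the diagonalization; with equal sides it passes commutation on
  to functions of a matrix.\<close>

lemma spectral_intertwine:
  fixes U V M :: "'m::finite cmat"
  assumes U: "unitary U" and V: "unitary V"
    and eq: "(U ** diagm d ** adj U) ** M = M ** (V ** diagm e ** adj V)"
  shows "(U ** diagm (f \<circ> d) ** adj U) ** M = M ** (V ** diagm (f \<circ> e) ** adj V)"
proof -
  define W where "W = adj U ** M ** V"
  have M: "M = U ** W ** adj V"
    using unitary_cancel(4)[OF V, of M] unitary_cancel(2)[OF U, of "M ** V ** adj V"]
    by (simp add: W_def matrix_mul_assoc)
  have "adj U ** ((U ** diagm d ** adj U) ** M) ** V = adj U ** (M ** (V ** diagm e ** adj V)) ** V"
    by (simp add: eq)
  moreover have "adj U ** ((U ** diagm d ** adj U) ** M) ** V = diagm d ** W"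
    using unitary_cancel(1)[OF U, of "diagm d ** adj U ** M ** V"] by (simp add: W_def matrix_mul_assoc)
  moreover have "adj U ** (M ** (V ** diagm e ** adj V)) ** V = W ** diagm e"
    using unitary_cancel(3)[OF V, of "adj U ** M ** V ** diagm e"] by (simp add: W_def matrix_mul_assoc)
  ultimately have "diagm d ** W = W ** diagm e" by simp
  then have "complex_of_real (d i) * W $ i $ j = W $ i $ j * complex_of_real (e j)" for i j
    by (metis diagm_mult_left diagm_mult_right)
  then have "d i = e j \<or> W $ i $ j = 0" for i j
    by (metis mult.commute mult_cancel_right of_real_eq_iff)
  then have fW: "diagm (f \<circ> d) ** W = W ** diagm (f \<circ> e)"
    by (simp add: vec_eq_iff diagm_mult_left diagm_mult_right) metis
  have "(U ** diagm (f \<circ> d) ** adj U) ** M = U ** (diagm (f \<circ> d) ** W) ** adj V"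
    using unitary_cancel(1)[OF U, of "W ** adj V"] by (simp add: M matrix_mul_assoc[symmetric])
  also have "\<dots> = M ** (V ** diagm (f \<circ> e) ** adj V)"
    using unitary_cancel(1)[OF V, of "diagm (f \<circ> e) ** adj V"] by (simp add: fW M matrix_mul_assoc[symmetric])
  finally show ?thesis .
qed

lemma hfun_spectral:
  assumes U: "unitary U"
  shows "hfun f (U ** diagm d ** adj U) = U ** diagm (f \<circ> d) ** adj U"
  unfolding hfun_def
proof (rule the_equality)
  show "\<exists>Ua da. unitary Ua \<and> U ** diagm d ** adj U = Ua ** diagm da ** adj Ua
      \<and> U ** diagm (f \<circ> d) ** adj U = Ua ** diagm (f \<circ> da) ** adj Ua"
    using U by blast
next
  fix X assume "\<exists>Ua da. unitary Ua \<and> U ** diagm d ** adj U = Ua ** diagm da ** adj Ua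
      \<and> X = Ua ** diagm (f \<circ> da) ** adj Ua"
  then obtain V e where "unitary V" "U ** diagm d ** adj U = V ** diagm e ** adj V"
      "X = V ** diagm (f \<circ> e) ** adj V" by blast
  then show "X = U ** diagm (f \<circ> d) ** adj U"
    using spectral_intertwine[OF U, of V d "mat 1" e f] by simp
qed

lemma hfun_diagm: "hfun f (diagm d) = diagm (f \<circ> d)"
  using hfun_spectral[OF unitary_mat1, of f d] by simp

lemma hermitian_spectral [simp]: "hermitian (U ** diagm d ** adj U)"
  by (simp add: hermitian_congruence)

lemma hermitian_hfun [simp]: "hermitian A \<Longrightarrow> hermitian (hfun f A)"
  by (metis hermitian_spectral hfun_spectral spectral)

lemma hfun_hfun: "hermitian A \<Longrightarrow> hfun g (hfun f A) = hfun (g \<circ> f) A"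
  by (erule spectral) (simp add: hfun_spectral comp_assoc)

lemma spectral_mult:
  assumes "unitary U"
  shows "(U ** diagm a ** adj U) ** (U ** diagm b ** adj U) = U ** diagm (\<lambda>i. a i * b i) ** adj U"
  using unitary_cancel(1)[OF assms, of "diagm b ** adj U"]
  by (simp add: diagm_diagm[symmetric] matrix_mul_assoc[symmetric])

lemma spectral_scaleR: "r *\<^sub>R (U ** diagm a ** adj U) = U ** diagm (\<lambda>i. r * a i) ** adj U"
  by (simp add: diagm_scaleR[symmetric] cmult_scaleR_left cmult_scaleR_right)

lemma spectral_component:
  "(U ** diagm d ** adj U) $ i $ j = (\<Sum>p\<in>UNIV. U $ i $ p * complex_of_real (d p) * cnj (U $ j $ p))"
  by (subst matrix_matrix_mult_def) (simp add: diagm_mult_right)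

lemma spectral_add: "U ** diagm a ** adj U + U ** diagm b ** adj U = U ** diagm (\<lambda>i. a i + b i) ** adj U"
  by (simp add: vec_eq_iff spectral_component sum.distrib[symmetric] distrib_left distrib_right)

lemma spectral_diff: "U ** diagm a ** adj U - U ** diagm b ** adj U = U ** diagm (\<lambda>i. a i - b i) ** adj U"
  by (simp add: diagm_diff[symmetric] cmult_diff_left cmult_diff_right)

lemma hfun_mult: "hermitian A \<Longrightarrow> hfun f A ** hfun g A = hfun (\<lambda>x. f x * g x) A"
  by (erule spectral) (simp add: hfun_spectral spectral_mult comp_def)

lemma hfun_ident: "hermitian A \<Longrightarrow> hfun (\<lambda>x. x) A = A"
  by (erule spectral) (simp add: hfun_spectral comp_def)

lemma hfun_scaleR: "hermitian A \<Longrightarrow> hfun f (r *\<^sub>R A) = hfun (\<lambda>x. f (r * x)) A"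
  by (erule spectral) (simp add: hfun_spectral spectral_scaleR comp_def)

lemma hfun_commute:
  assumes "hermitian A" "A ** M = M ** A"
  shows "hfun f A ** M = M ** hfun f A"
proof -
  obtain U a where "unitary U" "A = U ** diagm a ** adj U" using spectral[OF assms(1)] .
  then show ?thesis using spectral_intertwine[of U U a M a f] assms(2) by (simp add: hfun_spectral)
qed

lemma unitary_conj_spectral:
  "adj U ** (V ** diagm d ** adj V) ** U = (adj U ** V) ** diagm d ** adj (adj U ** V)"
  by (simp add: adj_mult matrix_mul_assoc)

lemma hfun_unitary_conj:
  assumes U: "unitary U" and A: "hermitian A"
  shows "hfun f (adj U ** A ** U) = adj U ** hfun f A ** U"
proof -
  obtain V d where V: "unitary V" "A = V ** diagm d ** adj V" using spectral[OF A] .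
  have "unitary (adj U ** V)" using U V unitary_adj unitary_mult by blast
  from hfun_spectral[OF this] show ?thesis
    using V by (simp only: unitary_conj_spectral hfun_spectral)
qed

text \<open>Diagonal entries are averages of eigenvalues, the weights summing to one along each row;
  scalar calculus and convexity reach matrices this way.\<close>

lemma spectral_diag:
  "Re ((U ** diagm d ** adj U) $ i $ i) = (\<Sum>p\<in>UNIV. (cmod (U $ i $ p))\<^sup>2 * d p)"
proof -
  have "Re (z * complex_of_real r * cnj z) = (cmod z)\<^sup>2 * r" for z r
    by (simp add: cmod_power2) (simp add: power2_eq_square algebra_simps)
  then show ?thesis by (simp add: spectral_component)
qed

lemma unitary_row_norm: "unitary U \<Longrightarrow> (\<Sum>p\<in>UNIV. (cmod (U $ i $ p))\<^sup>2) = 1"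
  using spectral_diag[of U "\<lambda>_. 1" i] by (simp add: diagm_one unitary_def) (simp add: mat_def)

lemma unitary_column_norm: "unitary U \<Longrightarrow> (\<Sum>i\<in>UNIV. (cmod (U $ i $ p))\<^sup>2) = 1"
  using unitary_row_norm[OF unitary_adj, of U p] by simp

lemma spectral_trace:
  assumes "unitary U"
  shows "(\<Sum>i\<in>UNIV. Re ((U ** diagm d ** adj U) $ i $ i)) = (\<Sum>p\<in>UNIV. d p)"
proof -
  have "(\<Sum>i\<in>UNIV. Re ((U ** diagm d ** adj U) $ i $ i)) = (\<Sum>p\<in>UNIV. \<Sum>i\<in>UNIV. (cmod (U $ i $ p))\<^sup>2 * d p)"
    by (subst sum.swap) (simp add: spectral_diag)
  then show ?thesis
    by (simp add: sum_distrib_right[symmetric] unitary_column_norm[OF assms])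
qed

lemma spectral_det:
  assumes "unitary (U::'m::finite cmat)"
  shows "det (U ** diagm d ** adj U) = complex_of_real (\<Prod>p\<in>UNIV. d p)"
proof -
  have "det U * det (adj U) = 1"
    using assms by (metis unitary_def det_mul det_I)
  moreover have "det (diagm d :: 'm cmat) = (\<Prod>p\<in>UNIV. complex_of_real (d p))"
    by (subst det_diagonal) (auto simp: diagm_component)
  ultimately show ?thesis by (simp add: det_mul mult_ac)
qed

section \<open>Positive definite matrices\<close>

lemma pd_congruence:
  assumes A: "pd A" and M: "M' ** M = mat 1"
  shows "pd (adj M ** A ** M)"
proof -
  have "hermitian (adj M ** A ** M)"
    using A hermitian_congruence[of A "adj M"] by (simp add: pd_def)
  moreover have "0 < Re (qform (adj M ** A ** M) x)" if "x \<noteq> 0" for x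
  proof -
    have "M *v x \<noteq> 0"
      using M that by (metis matrix_vector_mul_assoc matrix_vector_mul_lid matrix_vector_mult_0_right)
    moreover have "inner x ((adj M ** A ** M) *v x) = inner (M *v x) (A *v (M *v x))"
      using inner_adj[of x "adj M"] by (simp add: matrix_vector_mul_assoc[symmetric] matrix_mul_assoc[symmetric])
    ultimately show ?thesis using A by (simp add: pd_def Re_qform)
  qed
  ultimately show ?thesis by (simp add: pd_def)
qed

lemma diagm_vec: "(diagm d *v x) $ i = d i *\<^sub>R x $ i"
proof -
  have "(diagm d *v x) $ i = (\<Sum>j\<in>UNIV. if i = j then complex_of_real (d i) * x $ j else 0)"
    by (simp add: matrix_vector_mult_def diagm_component if_distrib[of "\<lambda>z. z * _"] cong: if_cong)
  then show ?thesis by (simp add: scaleR_conv_of_real[where 'a=complex])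
qed

lemma inner_diagm: "inner x (diagm d *v x) = (\<Sum>i\<in>UNIV. d i * (cmod (x $ i))\<^sup>2)"
  by (simp add: inner_vec_def diagm_vec power2_norm_eq_inner)

lemma pd_diagm: "pd (diagm d) \<longleftrightarrow> (\<forall>i. 0 < d i)"
proof
  assume p: "pd (diagm d)"
  show "\<forall>i. 0 < d i"
  proof
    fix i
    have "(axis i 1 :: complex^'a) \<noteq> 0" by (simp add: axis_eq_0_iff)
    with p have "0 < inner (axis i (1::complex)) (diagm d *v axis i 1)" by (simp add: pd_def Re_qform)
    also have "\<dots> = (\<Sum>j\<in>UNIV. if j = i then d j else 0)"
      unfolding inner_diagm by (intro sum.cong) (auto simp: axis_def)
    finally show "0 < d i" by simp
  qed
next
  assume d: "\<forall>i. 0 < d i"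
  have "0 < (\<Sum>i\<in>UNIV. d i * (cmod (x $ i))\<^sup>2)" if "x \<noteq> 0" for x :: "complex^'a"
  proof -
    obtain i where "x $ i \<noteq> 0" using \<open>x \<noteq> 0\<close> by (auto simp: vec_eq_iff)
    then show ?thesis using d
      by (intro sum_pos2[of _ i]) (auto intro!: mult_pos_pos mult_nonneg_nonneg intro: less_imp_le)
  qed
  then show "pd (diagm d)" by (simp add: pd_def Re_qform inner_diagm)
qed

lemma pd_spectral_iff:
  assumes U: "unitary U"
  shows "pd (U ** diagm d ** adj U) \<longleftrightarrow> (\<forall>i. 0 < d i)"
proof
  assume "\<forall>i. 0 < d i"
  then show "pd (U ** diagm d ** adj U)"
    using pd_congruence[of "diagm d" U "adj U"] U by (simp add: pd_diagm unitary_def)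
next
  assume "pd (U ** diagm d ** adj U)"
  then have "pd (adj U ** (U ** diagm d ** adj U) ** U)"
    using pd_congruence[of _ "adj U" U] U by (simp add: unitary_def)
  then have "pd (diagm d)"
    using unitary_cancel(1)[OF U, of "diagm d ** adj U ** U"] U
    by (simp add: matrix_mul_assoc[symmetric] unitary_def)
  then show "\<forall>i. 0 < d i" by (simp add: pd_diagm)
qed

lemma pd_hermitian: "pd A \<Longrightarrow> hermitian A"
  by (simp add: pd_def)

lemma pd_spectral:
  assumes "pd A"
  obtains U a where "unitary U" "A = U ** diagm a ** adj U" "\<And>i. 0 < a i"
  using spectral[OF pd_hermitian[OF assms]] assms pd_spectral_iff by metis

lemma pd_unitary_conj: "unitary U \<Longrightarrow> pd A \<Longrightarrow> pd (adj U ** A ** U)"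
  using pd_congruence[of A "adj U" U] by (simp add: unitary_def)

lemma hfun_cong_pd:
  assumes A: "pd A" and fg: "\<And>x. 0 < x \<Longrightarrow> f x = g x"
  shows "hfun f A = hfun g A"
proof -
  obtain U a where "unitary U" "A = U ** diagm a ** adj U" "\<And>i. 0 < a i" using pd_spectral[OF A] by blast
  then show ?thesis using fg by (simp add: hfun_spectral comp_def)
qed

lemma pd_hfun:
  assumes A: "pd A" and f: "\<And>x. 0 < x \<Longrightarrow> 0 < f x"
  shows "pd (hfun f A)"
proof -
  obtain U a where "unitary U" "A = U ** diagm a ** adj U" "\<And>i. 0 < a i" using pd_spectral[OF A] by blast
  then show ?thesis using f by (simp add: hfun_spectral pd_spectral_iff)
qed

section \<open>Exponential, logarithm and real powers\<close>

lemma pd_mexp: "hermitian H \<Longrightarrow> pd (mexp H)"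
  by (erule spectral) (simp add: mexp_def hfun_spectral pd_spectral_iff)

lemma pd_mpow: "pd A \<Longrightarrow> pd (mpow A t)"
  by (simp add: mpow_def pd_hfun)

lemma hermitian_mlog: "pd A \<Longrightarrow> hermitian (mlog A)"
  by (simp add: mlog_def pd_hermitian)

lemma mlog_mexp: "hermitian H \<Longrightarrow> mlog (mexp H) = H"
  by (simp add: mlog_def mexp_def hfun_hfun comp_def hfun_ident)

lemma mexp_mlog:
  assumes "pd A" shows "mexp (mlog A) = A"
proof -
  have "mexp (mlog A) = hfun (exp \<circ> ln) A"
    by (simp add: mlog_def mexp_def hfun_hfun pd_hermitian[OF assms])
  also have "\<dots> = hfun (\<lambda>x. x) A" by (rule hfun_cong_pd[OF assms]) simp
  finally show ?thesis by (simp add: hfun_ident pd_hermitian[OF assms])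
qed

lemma mpow_mexp: "hermitian H \<Longrightarrow> mpow (mexp H) t = mexp (t *\<^sub>R H)"
  by (simp add: mpow_def mexp_def hfun_hfun hfun_scaleR comp_def powr_def mult.commute)

lemma mpow_eq_mexp: "pd A \<Longrightarrow> mpow A t = mexp (t *\<^sub>R mlog A)"
  by (metis mpow_mexp mexp_mlog hermitian_mlog)

lemma mlog_mpow: "pd A \<Longrightarrow> mlog (mpow A t) = t *\<^sub>R mlog A"
  by (simp add: mpow_eq_mexp mlog_mexp hermitian_scaleR hermitian_mlog)

lemma mpow_mpow: "pd A \<Longrightarrow> mpow (mpow A s) t = mpow A (s * t)"
  by (simp add: mpow_eq_mexp mpow_mexp mlog_mexp hermitian_scaleR hermitian_mlog mult.commute)

lemma mpow_one: "pd A \<Longrightarrow> mpow A 1 = A"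
  by (simp add: mpow_eq_mexp mexp_mlog)

lemma mexp_mult: "hermitian H \<Longrightarrow> mexp (s *\<^sub>R H) ** mexp (t *\<^sub>R H) = mexp ((s + t) *\<^sub>R H)"
  by (simp add: mexp_def hfun_scaleR hfun_mult exp_add distrib_right)

lemma mexp_zero: "mexp (0::'m::finite cmat) = mat 1"
proof -
  have "(0::'m cmat) = diagm (\<lambda>_. 0)" by (simp add: vec_eq_iff diagm_component)
  then have "mexp (0::'m cmat) = mexp (diagm (\<lambda>_. 0))" by simp
  then show ?thesis by (simp only: mexp_def hfun_diagm comp_def exp_zero diagm_one)
qed

lemma mpow_mult: "pd A \<Longrightarrow> mpow A s ** mpow A t = mpow A (s + t)"
  by (simp add: mpow_eq_mexp mexp_mult hermitian_mlog)

lemma mpow_zero: "pd A \<Longrightarrow> mpow A 0 = mat 1"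
  by (simp add: mpow_eq_mexp mexp_zero)

lemma adj_mpow: "pd A \<Longrightarrow> adj (mpow A t) = mpow A t"
  using pd_mpow pd_hermitian hermitian_def by blast

lemma pd_mpow_congruence: "pd X \<Longrightarrow> pd A \<Longrightarrow> pd (mpow X t ** A ** mpow X t)"
  using pd_congruence[of A "mpow X (-t)" "mpow X t"] by (simp add: adj_mpow mpow_mult mpow_zero)

lemma mlog_unitary_conj: "unitary U \<Longrightarrow> hermitian A \<Longrightarrow> mlog (adj U ** A ** U) = adj U ** mlog A ** U"
  by (simp add: mlog_def hfun_unitary_conj)

lemma trace_mlog:
  fixes B :: "'m::finite cmat"
  assumes "pd B"
  shows "(\<Sum>i\<in>UNIV. Re (mlog B $ i $ i)) = ln (Re (det B))" "0 < Re (det B)"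
     "det B = complex_of_real (Re (det B))"
proof -
  obtain U b where U: "unitary U" and B: "B = U ** diagm b ** adj U" and b: "\<And>i. 0 < b i"
    using pd_spectral[OF assms] by blast
  have "(\<Sum>i\<in>UNIV. Re (mlog B $ i $ i)) = (\<Sum>p\<in>UNIV. ln (b p))"
    using U by (simp add: B mlog_def hfun_spectral spectral_trace)
  moreover have d: "det B = complex_of_real (\<Prod>p\<in>UNIV. b p)"
    using U by (simp only: B spectral_det)
  moreover have "ln (\<Prod>p\<in>UNIV. b p) = (\<Sum>p\<in>UNIV. ln (b p))"
    using b by (intro ln_prod) (auto simp: less_le)
  moreover have "0 < (\<Prod>p\<in>UNIV. b p)" by (simp add: b prod_pos)
  ultimately show "(\<Sum>i\<in>UNIV. Re (mlog B $ i $ i)) = ln (Re (det B))" "0 < Re (det B)"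
     "det B = complex_of_real (Re (det B))" by (simp_all only: Re_complex_of_real)
qed

lemma pd_diagm_congruence:
  assumes B: "pd B" and c: "\<And>i. 0 < c i"
  shows "pd (diagm c ** B ** diagm c)"
proof -
  have "diagm (\<lambda>i. inverse (c i)) ** diagm c = mat 1"
    using c by (simp add: diagm_diagm diagm_one less_imp_neq[symmetric])
  from pd_congruence[OF B this] show ?thesis by simp
qed

text \<open>The trace of the logarithm is the logarithm of the determinant, which is multiplicative;
  so the total change is known exactly although single diagonal entries are not.\<close>

lemma trace_mlog_diagm_congruence:
  fixes B :: "'m::finite cmat"
  assumes B: "pd B" and c: "\<And>i. 0 < c i"
  shows "(\<Sum>i\<in>UNIV. Re (mlog (diagm c ** B ** diagm c) $ i $ i))
     = (\<Sum>i\<in>UNIV. Re (mlog B $ i $ i)) + (\<Sum>i\<in>UNIV. 2 * ln (c i))"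
proof -
  have d: "det (diagm c :: 'm cmat) = complex_of_real (\<Prod>p\<in>UNIV. c p)"
    using spectral_det[OF unitary_mat1, of c] by simp
  define r where "r = (\<Prod>p\<in>UNIV. c p)"
  have r: "r > 0" "ln r = (\<Sum>i\<in>UNIV. ln (c i))"
    unfolding r_def using c by (auto intro!: prod_pos ln_prod simp: less_imp_neq[symmetric])
  have "Re (det (diagm c ** B ** diagm c)) = r * r * Re (det B)"
    using trace_mlog(3)[OF B] by (simp add: det_mul d r_def[symmetric])
  then show ?thesis
    using trace_mlog[OF B] trace_mlog(1)[OF pd_diagm_congruence[OF B c]] r
    by (simp add: ln_mult sum_distrib_left[symmetric])
qed

section \<open>Diagonal entries of the logarithm under congruence\<close>

definition resolvent :: "real \<Rightarrow> 'm::finite cmat \<Rightarrow> 'm cmat" where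
  "resolvent s B = hfun (\<lambda>x. 1 / (x + s)) B"

lemma resolvent_equation:
  assumes B: "pd B" and s: "0 \<le> s"
  shows "B *v (resolvent s B *v e) + s *\<^sub>R (resolvent s B *v e) = e"
proof -
  have h: "hermitian B" by (rule pd_hermitian[OF B])
  have "B ** resolvent s B = hfun (\<lambda>x. x * (1 / (x + s))) B"
    using hfun_mult[OF h, of "\<lambda>x. x" "\<lambda>x. 1 / (x + s)"] by (simp add: resolvent_def hfun_ident[OF h])
  also have "\<dots> = hfun (\<lambda>x. 1 - s * (1 / (x + s))) B"
    by (rule hfun_cong_pd[OF B]) (use s in \<open>simp add: field_simps\<close>)
  also have "\<dots> = mat 1 - s *\<^sub>R resolvent s B"
    unfolding resolvent_def
    by (rule spectral[OF h])
       (simp add: hfun_spectral spectral_scaleR comp_def spectral_diff[symmetric] diagm_one unitary_def)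
  finally have "B ** resolvent s B + s *\<^sub>R resolvent s B = mat 1" by simp
  then have "(B ** resolvent s B + s *\<^sub>R resolvent s B) *v e = e" by simp
  moreover have "(s *\<^sub>R resolvent s B) *v e = s *\<^sub>R (resolvent s B *v e)"
    by (simp add: vec_eq_iff matrix_vector_mult_def scaleR_sum_right)
  ultimately show ?thesis
    by (simp add: matrix_vector_mult_add_rdistrib matrix_vector_mul_assoc)
qed

lemma matrix_axis: "((A::'m::finite cmat) *v axis i 1) $ j = A $ j $ i"
  by (simp add: matrix_vector_mult_def axis_def if_distrib[of "\<lambda>z. _ * z"] cong: if_cong)

lemma inner_axis_complex: "inner x (axis i (1::complex)) = Re (x $ i)"
  by (simp add: inner_axis inner_complex_def)

text \<open>Let C = diagm d, x = (B + s)^-1 e and z = C (C B C + s)^-1 e. Then z solves the equation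
  of x with s replaced by the smaller s C^-2. The form of B + s C^-2 at z - x is nonnegative;
  expanding it gives the claim with a deficit term that later decides the equality case.\<close>

lemma resolvent_gap:
  fixes B :: "'m::finite cmat"
  assumes B: "pd B" and s: "0 \<le> s" and d1: "\<And>j. 1 \<le> d j" and di: "d i = 1"
  shows "Re (resolvent s B $ i $ i) + s * (\<Sum>j\<in>UNIV. (1 - 1 / (d j)\<^sup>2) * (cmod (resolvent s B $ j $ i))\<^sup>2)
     \<le> Re (resolvent s (diagm d ** B ** diagm d) $ i $ i)"
proof -
  define e :: "complex^'m" where "e = axis i 1"
  define C where "C = (diagm d :: 'm cmat)"
  define E :: "'m cmat" where "E = diagm (\<lambda>j. 1 / (d j)\<^sup>2)"
  define x where "x = resolvent s B *v e"
  define y where "y = resolvent s (C ** B ** C) *v e"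
  define z where "z = C *v y"
  have d0: "0 < d j" "d j \<noteq> 0" for j using d1[of j] by auto
  have x: "B *v x + s *\<^sub>R x = e"
    unfolding x_def by (rule resolvent_equation[OF B s])
  have y: "(C ** B ** C) *v y + s *\<^sub>R y = e"
    unfolding y_def C_def by (rule resolvent_equation[OF pd_diagm_congruence[OF B d0(1)] s])
  have z: "B *v z + s *\<^sub>R (E *v z) = e"
  proof -
    have "C *v (B *v z) + s *\<^sub>R y = e" using y by (simp add: z_def matrix_vector_mul_assoc matrix_mul_assoc)
    then have "d j *\<^sub>R (B *v z) $ j + s *\<^sub>R y $ j = e $ j" for j
      by (auto simp: C_def diagm_vec vec_eq_iff)
    \<comment> \<open>\<open>d i = 1\<close> makes \<open>C\<close> fix \<open>e\<close>, so the
      right-hand side is unchanged when the equation is divided by \<open>C\<close>.\<close>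
    have "y $ j = (1 / d j) *\<^sub>R z $ j" "e $ j = d j *\<^sub>R e $ j" for j
      using d0[of j] di by (auto simp: z_def C_def diagm_vec e_def axis_def)
    have "d j *\<^sub>R ((B *v z) $ j + s *\<^sub>R ((1 / (d j)\<^sup>2) *\<^sub>R z $ j)) = d j *\<^sub>R e $ j" for j
    proof -
      have "d j * (s * (1 / (d j)\<^sup>2)) = s * (1 / d j)"
        using d0[of j] by (simp add: power2_eq_square)
      then have "d j *\<^sub>R ((B *v z) $ j + s *\<^sub>R ((1 / (d j)\<^sup>2) *\<^sub>R z $ j))
          = d j *\<^sub>R (B *v z) $ j + s *\<^sub>R ((1 / d j) *\<^sub>R z $ j)"
        by (simp only: scaleR_right_distrib scaleR_scaleR)
      then show ?thesis
        using \<open>\<And>j. d j *\<^sub>R (B *v z) $ j + s *\<^sub>R y $ j = e $ j\<close>[of j]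
          \<open>\<And>j. y $ j = (1 / d j) *\<^sub>R z $ j\<close>[of j] \<open>\<And>j. e $ j = d j *\<^sub>R e $ j\<close>[of j] by simp
    qed
    then have "(B *v z) $ j + s *\<^sub>R ((1 / (d j)\<^sup>2) *\<^sub>R z $ j) = e $ j" for j
      using d0(2)[of j] by (simp only: real_vector.scale_cancel_left) blast
    then show ?thesis by (simp add: vec_eq_iff E_def diagm_vec)
  qed
  define v where "v = z - x"
  have "0 \<le> inner v (B *v v)"
    using B by (cases "v = 0") (auto simp: pd_def Re_qform intro: less_imp_le)
  moreover have "0 \<le> s * inner v (E *v v)"
    using s by (auto simp: E_def inner_diagm intro!: mult_nonneg_nonneg sum_nonneg)
  ultimately have "0 \<le> inner v (B *v v + s *\<^sub>R (E *v v))" by (simp add: inner_add_right)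
  also have "B *v v + s *\<^sub>R (E *v v) = e - (B *v x + s *\<^sub>R (E *v x))"
    using z by (simp add: v_def matrix_vector_mult_diff_distrib scaleR_right_diff_distrib algebra_simps)
  also have "\<dots> = s *\<^sub>R x - s *\<^sub>R (E *v x)" by (subst x[symmetric]) simp
  also have "inner v \<dots> = inner z (s *\<^sub>R x - s *\<^sub>R (E *v x)) - s * (inner x x - inner x (E *v x))"
    by (simp add: v_def inner_diff_left inner_diff_right right_diff_distrib)
  also have "inner z (s *\<^sub>R x - s *\<^sub>R (E *v x)) = inner z e - inner x e"
  proof -
    have "inner z (B *v x) = inner x (B *v z)" "inner z (E *v x) = inner x (E *v z)"
      using inner_adj[of z B x] inner_adj[of z E x] pd_hermitian[OF B]
      by (simp_all add: hermitian_def E_def inner_commute)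
    moreover have "inner z e = inner z (B *v x) + s * inner z x"
      by (subst x[symmetric]) (simp add: inner_add_right)
    moreover have "inner x e = inner x (B *v z) + s * inner x (E *v z)"
      by (subst z[symmetric]) (simp add: inner_add_right)
    ultimately show ?thesis by (simp add: inner_diff_right)
  qed
  finally have "inner x e + s * (inner x x - inner x (E *v x)) \<le> inner z e" by simp
  moreover have "inner x x - inner x (E *v x) = (\<Sum>j\<in>UNIV. (1 - 1 / (d j)\<^sup>2) * (cmod (x $ j))\<^sup>2)"
  proof -
    have "inner x x = (\<Sum>j\<in>UNIV. (cmod (x $ j))\<^sup>2)" by (simp add: inner_vec_def power2_norm_eq_inner)
    then show ?thesis by (simp add: E_def inner_diagm left_diff_distrib sum_subtractf)
  qed
  moreover have "x $ j = resolvent s B $ j $ i" for j by (simp add: x_def e_def matrix_axis)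
  moreover have "z $ i = resolvent s (C ** B ** C) $ i $ i"
    by (simp add: z_def y_def C_def diagm_vec di e_def matrix_axis)
  ultimately show ?thesis by (simp add: e_def inner_axis_complex C_def)
qed

text \<open>With logarithms shifted by $s$ the two sides of the comparison of $\log B$ and $\log(CBC)$
  become equal as $s \to \infty$, so their order at $s = 0$ follows from that of their derivatives, the resolvents.\<close>

lemma hfun_diag_deriv:
  assumes B: "pd B" and s: "0 \<le> s"
  shows "((\<lambda>s. Re (hfun (\<lambda>x. ln (x + s)) B $ i $ i)) has_real_derivative Re (resolvent s B $ i $ i)) (at s)"
proof -
  obtain U b where U: "unitary U" and Bb: "B = U ** diagm b ** adj U" and b: "\<And>p. 0 < b p"
    using pd_spectral[OF B] by blast
  have "((\<lambda>s. \<Sum>p\<in>UNIV. (cmod (U $ i $ p))\<^sup>2 * ln (b p + s)) has_real_derivative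
      (\<Sum>p\<in>UNIV. (cmod (U $ i $ p))\<^sup>2 * (1 / (b p + s)))) (at s)"
    using b s by (auto intro!: derivative_eq_intros sum.cong simp: add_pos_nonneg)
  then show ?thesis
    by (simp add: Bb hfun_spectral[OF U] resolvent_def spectral_diag comp_def)
qed

text \<open>The row weights sum to one, so a single ln s can be subtracted from the average; it
  cancels when two matrices are compared.\<close>

lemma hfun_diag_limit:
  assumes B: "pd B"
  shows "((\<lambda>s. Re (hfun (\<lambda>x. ln (x + s)) B $ i $ i) - ln s) \<longlongrightarrow> 0) at_top"
proof -
  obtain U b where U: "unitary U" and Bb: "B = U ** diagm b ** adj U" and b: "\<And>p. 0 < b p"
    using pd_spectral[OF B] by blast
  have "((\<lambda>s. ln (b p + s) - ln s) \<longlongrightarrow> 0) at_top" for p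
  proof (rule Lim_transform_eventually)
    have "((\<lambda>s. ln (1 + b p * inverse s)) \<longlongrightarrow> ln (1 + b p * 0)) at_top"
      by (intro tendsto_intros tendsto_inverse_0_at_top filterlim_ident) auto
    then show "((\<lambda>s. ln (1 + b p * inverse s)) \<longlongrightarrow> 0) at_top" by simp
    show "\<forall>\<^sub>F s in at_top. ln (1 + b p * inverse s) = ln (b p + s) - ln s"
      using eventually_gt_at_top[of 0]
    proof eventually_elim
      case (elim s)
      then have "1 + b p * inverse s = (b p + s) / s" by (simp add: field_simps)
      then show ?case using elim b[of p] by (simp add: ln_div)
    qed
  qed
  then have lim: "((\<lambda>s. (cmod (U $ i $ p))\<^sup>2 * (ln (b p + s) - ln s)) \<longlongrightarrow> 0) at_top" for p
    by (rule tendsto_mult_right_zero)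
  have "((\<lambda>s. \<Sum>p\<in>UNIV. (cmod (U $ i $ p))\<^sup>2 * (ln (b p + s) - ln s)) \<longlongrightarrow> 0) at_top"
    using tendsto_sum[of UNIV "\<lambda>p s. (cmod (U $ i $ p))\<^sup>2 * (ln (b p + s) - ln s)" "\<lambda>_. 0", OF lim] by simp
  then show ?thesis
    by (simp add: Bb hfun_spectral[OF U] spectral_diag comp_def right_diff_distrib sum_subtractf
      sum_distrib_right[symmetric] unitary_row_norm[OF U])
qed

text \<open>The difference \<open>F\<close> of the shifted logarithms decreases to 0 at infinity, so
  it is nonnegative at 0. If it vanishes at 0, it vanishes on the whole half-line, and so do its
  derivative and the deficit term of \<open>resolvent_gap\<close>.\<close>

lemma mlog_diag_le:
  fixes B :: "'m::finite cmat"
  assumes B: "pd B" and d1: "\<And>j. 1 \<le> d j" and di: "d i = 1"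
  shows "Re (mlog (diagm d ** B ** diagm d) $ i $ i) \<le> Re (mlog B $ i $ i)"
    and "Re (mlog (diagm d ** B ** diagm d) $ i $ i) = Re (mlog B $ i $ i) \<Longrightarrow> 1 < d j
      \<Longrightarrow> resolvent 1 B $ j $ i = 0"
proof -
  define B' where "B' = diagm d ** B ** diagm d"
  have B': "pd B'" unfolding B'_def by (rule pd_diagm_congruence[OF B]) (use d1 in \<open>metis less_le_trans zero_less_one\<close>)
  define F where "F s = Re (hfun (\<lambda>x. ln (x + s)) B $ i $ i) - Re (hfun (\<lambda>x. ln (x + s)) B' $ i $ i)" for s
  define g where "g s = s * (\<Sum>j\<in>UNIV. (1 - 1 / (d j)\<^sup>2) * (cmod (resolvent s B $ j $ i))\<^sup>2)" for s
  have t0: "0 \<le> (1 - 1 / (d j)\<^sup>2) * r\<^sup>2" for j r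
  proof -
    have "1 \<le> (d j)\<^sup>2" using d1[of j] by (simp add: one_le_power)
    then have "1 / (d j)\<^sup>2 \<le> 1" by (simp add: divide_le_eq)
    then show ?thesis by simp
  qed
  have g0: "0 \<le> g s" if "0 \<le> s" for s
    unfolding g_def by (rule mult_nonneg_nonneg[OF that], rule sum_nonneg, rule t0)
  have F': "\<exists>D. (F has_real_derivative D) (at s) \<and> D \<le> - g s" if "0 \<le> s" for s
    using resolvent_gap[of B s d i, OF B that d1 di]
      DERIV_diff[OF hfun_diag_deriv[OF B that, of i] hfun_diag_deriv[OF B' that, of i]]
    by (intro exI conjI) (auto simp: F_def[abs_def] g_def B'_def)
  have mono: "F t \<le> F s" if "0 \<le> s" "s \<le> t" for s t
    using F' g0 that by (intro DERIV_nonpos_imp_nonincreasing[of s t F]) (auto, meson neg_le_0_iff_le order_trans)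
  have "(F \<longlongrightarrow> 0) at_top"
    using tendsto_diff[OF hfun_diag_limit[OF B, of i] hfun_diag_limit[OF B', of i]] by (simp add: F_def[abs_def])
  then have Fpos: "0 \<le> F s" if "0 \<le> s" for s
    using mono that by (elim tendsto_upperbound) (auto simp: eventually_at_top_linorder intro!: exI[of _ s])
  have F0: "F 0 = Re (mlog B $ i $ i) - Re (mlog B' $ i $ i)" by (simp add: F_def mlog_def)
  show "Re (mlog (diagm d ** B ** diagm d) $ i $ i) \<le> Re (mlog B $ i $ i)"
    using Fpos[of 0] F0 by (simp add: B'_def)
  assume eq: "Re (mlog (diagm d ** B ** diagm d) $ i $ i) = Re (mlog B $ i $ i)" and dj: "1 < d j"
  have "F s = 0" if "0 \<le> s" for s
    using Fpos[OF that] mono[of 0 s] that F0 eq by (simp add: B'_def)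
  \<comment> \<open>Any positive point serves in place of 1; at 0 the factor s in \<open>g\<close>
    would hide the deficit.\<close>
  moreover obtain D where D: "(F has_real_derivative D) (at 1)" "D \<le> - g 1" using F'[of 1] by auto
  ultimately have "D = 0" by (intro DERIV_local_const[OF D(1), of 1]) auto
  then have "g 1 = 0" using D g0[of 1] by simp
  then have "(1 - 1 / (d j)\<^sup>2) * (cmod (resolvent 1 B $ j $ i))\<^sup>2 = 0"
    unfolding g_def using t0 by (simp add: sum_nonneg_eq_0_iff)
  moreover have "1 < (d j)\<^sup>2" using dj by (simp add: one_less_power)
  then have "1 / (d j)\<^sup>2 < 1" by (simp add: divide_less_eq)
  ultimately show "resolvent 1 B $ j $ i = 0" by auto
qed

lemma commute_diagm_iff: "M ** diagm d = diagm d ** M \<longleftrightarrow> (\<forall>i j. d i \<noteq> d j \<longrightarrow> M $ i $ j = 0)"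
  by (simp add: vec_eq_iff diagm_mult_left diagm_mult_right) metis

text \<open>Vanishing corner blocks mean that the resolvent commutes with the projection onto the
  coordinates in \<open>S\<close>, and \<open>B\<close> is a function of its resolvent.\<close>

lemma block_diagonal_of_resolvent:
  assumes B: "pd B" and R: "\<And>i j. j \<in> S \<Longrightarrow> i \<notin> S \<Longrightarrow> resolvent 1 B $ j $ i = 0"
    and ij: "(i \<in> S) \<noteq> (j \<in> S)"
  shows "B $ i $ j = 0"
proof -
  have h: "hermitian B" by (rule pd_hermitian[OF B])
  then have hR: "hermitian (resolvent 1 B)" by (simp add: resolvent_def)
  let ?P = "diagm (\<lambda>i. if i \<in> S then 1 else 0)"
  have "resolvent 1 B $ i $ j = 0" if "(i \<in> S) \<noteq> (j \<in> S)" for i j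
    using R[of i j] R[of j i] hermitian_component[OF hR, of i j] that by auto
  then have "resolvent 1 B ** ?P = ?P ** resolvent 1 B"
    by (subst commute_diagm_iff) (auto split: if_splits)
  \<comment> \<open>If r = 1/(x + 1), then 1/r - 1 gives back x.\<close>
  from hfun_commute[OF hR this]
  have "hfun (\<lambda>r. 1 / r - 1) (resolvent 1 B) ** ?P = ?P ** hfun (\<lambda>r. 1 / r - 1) (resolvent 1 B)" .
  moreover have "hfun (\<lambda>r. 1 / r - 1) (resolvent 1 B) = hfun (\<lambda>x. x) B"
    unfolding resolvent_def hfun_hfun[OF h] by (rule hfun_cong_pd[OF B]) simp
  ultimately have "B ** ?P = ?P ** B" by (simp add: hfun_ident[OF h])
  then show ?thesis using ij unfolding commute_diagm_iff by (auto split: if_splits)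
qed

section \<open>The log gap of a diagonal congruence\<close>

definition expd :: "('m::finite \<Rightarrow> real) \<Rightarrow> 'm cmat" where
  "expd k = diagm (\<lambda>i. exp (k i / 2))"

text \<open>Measures on the diagonal how far log(exp(K/2) B exp(K/2)) is from log B + K, where K =
  diagm k; it is zero if B commutes with K.\<close>

definition log_gap :: "('m::finite \<Rightarrow> real) \<Rightarrow> 'm cmat \<Rightarrow> 'm \<Rightarrow> real" where
  "log_gap k B i = Re (mlog (expd k ** B ** expd k) $ i $ i) - Re (mlog B $ i $ i) - k i"

lemma pd_expd: "pd B \<Longrightarrow> pd (expd k ** B ** expd k)"
  unfolding expd_def by (rule pd_diagm_congruence) auto

text \<open>A cocycle rule: \<open>k\<close> can be applied one jump at a time, with
  \<open>B\<close> replaced by the congruent matrix reached so far.\<close>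

lemma log_gap_add:
  "log_gap (\<lambda>i. k i + l i) B i = log_gap k B i + log_gap l (expd k ** B ** expd k) i"
proof -
  have e: "expd (\<lambda>i. k i + l i) = expd k ** expd l" "expd (\<lambda>i. k i + l i) = expd l ** expd k"
    by (simp_all add: expd_def diagm_diagm exp_add[symmetric] add_divide_distrib add.commute)
  have "expd (\<lambda>i. k i + l i) ** B ** expd (\<lambda>i. k i + l i) = (expd l ** expd k) ** B ** (expd k ** expd l)"
    by (rule arg_cong2[of _ _ _ _ "\<lambda>X Y. X ** B ** Y", OF e(2) e(1)])
  also have "\<dots> = expd l ** (expd k ** B ** expd k) ** expd l"
    by (simp only: matrix_mul_assoc)
  finally have "expd (\<lambda>i. k i + l i) ** B ** expd (\<lambda>i. k i + l i)
      = expd l ** (expd k ** B ** expd k) ** expd l" .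
  then show ?thesis by (simp add: log_gap_def)
qed

lemma log_gap_const:
  assumes B: "pd B" shows "log_gap (\<lambda>_. c) B i = 0"
proof -
  have h: "hermitian B" by (rule pd_hermitian[OF B])
  have e: "expd (\<lambda>_. c) = exp (c/2) *\<^sub>R (mat 1 :: 'a cmat)"
    by (simp add: expd_def diagm_one[symmetric] diagm_scaleR)
  have "exp (c/2) * exp (c/2) = exp c" by (simp add: exp_add[symmetric])
  then have "expd (\<lambda>_. c) ** B ** expd (\<lambda>_. c) = exp c *\<^sub>R B"
    by (simp add: e cmult_scaleR_left cmult_scaleR_right)
  then have "mlog (expd (\<lambda>_. c) ** B ** expd (\<lambda>_. c)) = hfun (\<lambda>x. ln (exp c * x)) B"
    by (simp add: mlog_def hfun_scaleR[OF h])
  also have "\<dots> = hfun (\<lambda>x. c + ln x) B" by (rule hfun_cong_pd[OF B]) (simp add: ln_mult)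
  finally have m: "mlog (expd (\<lambda>_. c) ** B ** expd (\<lambda>_. c)) = hfun (\<lambda>x. c + ln x) B" .
  obtain U b where U: "unitary U" and Bb: "B = U ** diagm b ** adj U" using spectral[OF h] .
  show ?thesis
    unfolding log_gap_def m
    by (simp add: Bb mlog_def hfun_spectral[OF U] spectral_diag comp_def distrib_left sum.distrib
      sum_distrib_right[symmetric] unitary_row_norm[OF U])
qed

lemma sum_log_gap: "pd B \<Longrightarrow> (\<Sum>i\<in>UNIV. log_gap k B i) = 0"
  by (simp add: log_gap_def expd_def trace_mlog_diagm_congruence sum_subtractf)

lemma log_gap_step_le:
  assumes "pd B" "0 \<le> c" "i \<notin> S"
  shows "log_gap (\<lambda>i. if i \<in> S then c else 0) B i \<le> 0"
  using mlog_diag_le(1)[OF assms(1), of "\<lambda>i. exp ((if i \<in> S then c else 0) / 2)" i] assms(2,3)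
  by (simp add: log_gap_def expd_def)

text \<open>Raising the coordinates in \<open>S\<close> by \<open>c\<close> and then the others by
  \<open>c\<close> is a scalar operation with zero gap, and the second stage has nonpositive gap on
  \<open>S\<close>.\<close>

lemma log_gap_step_ge:
  assumes B: "pd B" and c: "0 \<le> c" and i: "i \<in> S"
  shows "0 \<le> log_gap (\<lambda>i. if i \<in> S then c else 0) B i"
proof -
  let ?k = "\<lambda>i. if i \<in> S then c else 0" and ?l = "\<lambda>i. if i \<in> - S then c else 0"
  have "(\<lambda>i. ?k i + ?l i) = (\<lambda>_. c)" by auto
  then have "log_gap ?k B i + log_gap ?l (expd ?k ** B ** expd ?k) i = 0"
    by (simp only: log_gap_add[symmetric] log_gap_const[OF B])
  moreover have "log_gap ?l (expd ?k ** B ** expd ?k) i \<le> 0"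
    by (rule log_gap_step_le[OF pd_expd[OF B] c]) (simp add: i)
  ultimately show ?thesis by linarith
qed

lemma sum_log_gap_Compl: "pd B \<Longrightarrow> (\<Sum>i\<in>T. log_gap k B i) = - (\<Sum>i\<in>-T. log_gap k B i)"
  using sum_log_gap[of B k] sum.subset_diff[of T UNIV "log_gap k B"] by (simp add: Compl_eq_Diff_UNIV)

text \<open>On \<open>S\<close> all gaps are nonnegative. If \<open>T\<close> contains
  \<open>S\<close>, the gaps outside \<open>T\<close> are nonpositive and the total is zero.\<close>

lemma sum_log_gap_step:
  assumes B: "pd B" and c: "0 \<le> c" and T: "T \<subseteq> S \<or> S \<subseteq> T"
  shows "0 \<le> (\<Sum>i\<in>T. log_gap (\<lambda>i. if i \<in> S then c else 0) B i)"
  using T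
proof
  assume "T \<subseteq> S"
  then show ?thesis using log_gap_step_ge[OF B c] by (intro sum_nonneg) auto
next
  assume "S \<subseteq> T"
  then have "(\<Sum>i\<in>-T. log_gap (\<lambda>i. if i \<in> S then c else 0) B i) \<le> 0"
    using log_gap_step_le[OF B c] by (intro sum_nonpos) auto
  then show ?thesis by (simp add: sum_log_gap_Compl[OF B, of _ T])
qed

text \<open>The zero total moves the equality to the complement of \<open>S\<close>. There every gap
  is nonpositive, so each one vanishes and the equality case of \<open>mlog_diag_le\<close>
  applies.\<close>

lemma log_gap_step_eq:
  assumes B: "pd B" and c: "0 < c" and eq: "(\<Sum>i\<in>S. log_gap (\<lambda>i. if i \<in> S then c else 0) B i) = 0"
    and ij: "(i \<in> S) \<noteq> (j \<in> S)"
  shows "B $ i $ j = 0"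
proof (rule block_diagonal_of_resolvent[OF B _ ij])
  fix i j assume "j \<in> S" "i \<notin> S"
  let ?k = "\<lambda>i. if i \<in> S then c else 0"
  have "(\<Sum>i\<in>-S. - log_gap ?k B i) = 0"
    using eq by (simp add: sum_log_gap_Compl[OF B, of _ S] sum_negf)
  then have "\<forall>i\<in>-S. - log_gap ?k B i = 0"
    by (subst (asm) sum_nonneg_eq_0_iff) (use log_gap_step_le[OF B, of c] c in auto)
  then have "log_gap ?k B i = 0" using \<open>i \<notin> S\<close> by auto
  then show "resolvent 1 B $ j $ i = 0"
    using mlog_diag_le(2)[OF B, of "\<lambda>i. exp (?k i / 2)" i j] \<open>j \<in> S\<close> \<open>i \<notin> S\<close> c
    by (simp add: log_gap_def expd_def)
qed

text \<open>The top sets of \<open>k\<close>. Ties may be cut anywhere, so there are more of them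
  than level sets.\<close>

definition upset :: "('m \<Rightarrow> real) \<Rightarrow> 'm set \<Rightarrow> bool" where
  "upset k T \<longleftrightarrow> (\<forall>i\<in>T. \<forall>j. j \<notin> T \<longrightarrow> k j \<le> k i)"

text \<open>Induction on the number of distinct values: \<open>k\<close> is a jump from the second
  largest value \<open>m\<close> to the largest \<open>M\<close> on the set \<open>S\<close> where
  \<open>M\<close> is attained, plus a remainder \<open>l\<close> with one value fewer. Every top
  set of \<open>k\<close> is one for both parts, so equality for \<open>k\<close> splits into
  equality for each.\<close>

theorem log_gap_majorization:
  fixes B :: "'m::finite cmat"
  assumes "pd B"
  shows "(\<forall>T. upset k T \<longrightarrow> 0 \<le> (\<Sum>i\<in>T. log_gap k B i))
    \<and> ((\<forall>c. (\<Sum>i | c \<le> k i. log_gap k B i) = 0) \<longrightarrow> (\<forall>i j. k i \<noteq> k j \<longrightarrow> B $ i $ j = 0))"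
  using assms
proof (induction "card (range k)" arbitrary: k B rule: less_induct)
  case less
  define M where "M = Max (range k)"
  have kM: "k i \<le> M" for i by (simp add: M_def)
  have MR: "M \<in> range k" unfolding M_def by (rule Max_in) auto
  show ?case
  proof (cases "range k - {M} = {}")
    case True
    then have "k = (\<lambda>_. M)" by auto
    then show ?thesis using log_gap_const[OF less.prems] by auto
  next
    case False
    define m where "m = Max (range k - {M})"
    have mR: "m \<in> range k - {M}" unfolding m_def using False by (intro Max_in) auto
    then have mM: "m < M" using kM by (metis DiffD1 DiffD2 insertI1 order.not_eq_order_implies_strict rangeE)
    have km: "k i \<le> m" if "k i \<noteq> M" for i
      unfolding m_def using that by (intro Max_ge) auto
    define S where "S = {i. k i = M}"
    define l where "l i = (if i \<in> S then m else k i)" for i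
    let ?s = "\<lambda>i. if i \<in> S then M - m else 0"
    have k: "k = (\<lambda>i. ?s i + l i)" by (auto simp: l_def S_def)
    define B' where "B' = expd ?s ** B ** expd ?s"
    have B': "pd B'" unfolding B'_def by (rule pd_expd[OF less.prems])
    have gap: "(\<Sum>i\<in>T. log_gap k B i) = (\<Sum>i\<in>T. log_gap ?s B i) + (\<Sum>i\<in>T. log_gap l B' i)" for T
      using log_gap_add[of ?s l B] by (simp only: k[symmetric] B'_def[symmetric] sum.distrib)
    have "range l \<subseteq> range k - {M}" using mR by (auto simp: l_def S_def)
    then have "card (range l) < card (range k)"
      using MR by (intro psubset_card_mono) auto
    note IH = less.hyps[OF this B']
    have step: "0 \<le> (\<Sum>i\<in>T. log_gap ?s B i)" if "upset k T" for T
    proof (rule sum_log_gap_step[OF less.prems])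
      \<comment> \<open>A top set that misses a maximal index contains only maximal ones.\<close>
      show "T \<subseteq> S \<or> S \<subseteq> T" using that kM unfolding upset_def S_def by (smt (verit, best) mem_Collect_eq subsetI)
    qed (use mM in simp)
    have up: "upset l T" if "upset k T" for T
      using that km unfolding upset_def l_def S_def by (smt (verit, best) kM mem_Collect_eq)
    have ge: "0 \<le> (\<Sum>i\<in>T. log_gap l B' i)" if "upset k T" for T
      using IH up[OF that] by blast
    show ?thesis
    proof (intro conjI impI allI)
      fix T assume "upset k T"
      then show "0 \<le> (\<Sum>i\<in>T. log_gap k B i)" using step ge gap by (metis add_nonneg_nonneg)
    next
      fix i j
      assume eq: "\<forall>c. (\<Sum>i | c \<le> k i. log_gap k B i) = 0" and kij: "k i \<noteq> k j"
      have upc: "upset k {i. c \<le> k i}" for c by (auto simp: upset_def)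
      have z: "(\<Sum>i | c \<le> k i. log_gap ?s B i) = 0" "(\<Sum>i | c \<le> k i. log_gap l B' i) = 0" for c
        using gap[of "{i. c \<le> k i}"] spec[OF eq, of c] step[OF upc[of c]] ge[OF upc[of c]]
        by linarith+
      have S: "{i. M \<le> k i} = S" using kM by (auto simp: S_def intro: order_antisym)
      show "B $ i $ j = 0"
      proof (cases "l i = l j")
        case True
        \<comment> \<open>The values merged in \<open>l\<close> are \<open>M\<close> and
          \<open>m\<close>, so the first jump already separates these two indices.\<close>
        then have "(i \<in> S) \<noteq> (j \<in> S)" using kij by (auto simp: l_def S_def split: if_splits)
        then show ?thesis using log_gap_step_eq[OF less.prems, of "M - m" S] z(1)[of M] mM unfolding S by auto
      next
        case False
        \<comment> \<open>Up to the level \<open>m\<close> the level sets of \<open>l\<close> and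
          \<open>k\<close> agree; above it those of \<open>l\<close> are empty.\<close>
        have "(\<Sum>i | c \<le> l i. log_gap l B' i) = 0" for c
        proof (cases "c \<le> m")
          case True
          then have "{i. c \<le> l i} = {i. c \<le> k i}" using mM by (auto simp: l_def S_def)
          then show ?thesis using z(2) by simp
        next
          case False
          then have "{i. c \<le> l i} = {}" using km by (auto simp: l_def S_def) (meson order_trans)
          then show ?thesis by simp
        qed
        then have "B' $ i $ j = 0" using IH False by blast
        \<comment> \<open>The entries of \<open>B'\<close> are those of \<open>B\<close> times
          positive factors.\<close>
        then show ?thesis by (simp add: B'_def expd_def diagm_mult_left diagm_mult_right)
      qed
    qed
  qed
qed

section \<open>Ordered majorization\<close>

text \<open>Abel summation without sorting: subtracting the least value of \<open>z\<close> drops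
  the indices where it is attained, and what was subtracted pairs with the sum of \<open>d\<close>
  over the top set \<open>I\<close>.\<close>

lemma layered_sum_nonneg_aux:
  fixes z d :: "'a \<Rightarrow> real"
  assumes "finite I" "\<And>i. i \<in> I \<Longrightarrow> 0 \<le> z i"
    and "\<And>T. T \<subseteq> I \<Longrightarrow> \<forall>i\<in>T. \<forall>j\<in>I - T. z j \<le> z i \<Longrightarrow> 0 \<le> sum d T"
  shows "0 \<le> (\<Sum>i\<in>I. z i * d i)"
  using assms
proof (induction "card I" arbitrary: I z rule: less_induct)
  case less
  show ?case
  proof (cases "I = {}")
    case False
    define m where "m = Min (z ` I)"
    have mle: "m \<le> z i" if "i \<in> I" for i using that less.prems(1) by (simp add: m_def)
    have "m \<in> z ` I" unfolding m_def using False less.prems(1) by (intro Min_in) auto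
    then obtain i0 where i0: "i0 \<in> I" "z i0 = m" by auto
    define J where "J = {i \<in> I. z i \<noteq> m}"
    have J: "J \<subseteq> I" "i0 \<notin> J" by (auto simp: J_def i0)
    have "0 \<le> (\<Sum>i\<in>J. (z i - m) * d i)"
    proof (rule less.hyps)
      show "card J < card I" using J i0 less.prems(1) by (intro psubset_card_mono) auto
      show "finite J" using J less.prems(1) finite_subset by blast
      show "0 \<le> z i - m" if "i \<in> J" for i using mle that J by auto
      show "0 \<le> sum d T" if T: "T \<subseteq> J" "\<forall>i\<in>T. \<forall>j\<in>J - T. z j - m \<le> z i - m" for T
      proof (rule less.prems(3))
        show "\<forall>i\<in>T. \<forall>j\<in>I - T. z j \<le> z i"
        proof (intro ballI)
          fix i j assume "i \<in> T" "j \<in> I - T"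
          then show "z j \<le> z i"
            using T mle[of i] J by (cases "j \<in> J") (auto simp: J_def)
        qed
      qed (use T J in auto)
    qed
    moreover have "0 \<le> m * sum d I"
      using less.prems(2)[OF i0(1)] i0(2) less.prems(3)[of I] by (intro mult_nonneg_nonneg) auto
    moreover have "(\<Sum>i\<in>I. z i * d i) = m * sum d I + (\<Sum>i\<in>I. (z i - m) * d i)"
      by (simp add: sum_distrib_left sum.distrib[symmetric] algebra_simps)
    moreover have "(\<Sum>i\<in>I. (z i - m) * d i) = (\<Sum>i\<in>J. (z i - m) * d i)"
      using J less.prems(1) by (intro sum.mono_neutral_right) (auto simp: J_def)
    ultimately show ?thesis by linarith
  qed simp
qed

lemma layered_sum_nonneg:
  fixes z d :: "'m::finite \<Rightarrow> real"
  assumes T: "\<And>T. upset z T \<Longrightarrow> 0 \<le> sum d T" and U: "sum d UNIV = 0"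
  shows "0 \<le> (\<Sum>i\<in>UNIV. z i * d i)"
proof -
  define m where "m = Min (range z)"
  have "0 \<le> (\<Sum>i\<in>UNIV. (z i - m) * d i)"
  proof (rule layered_sum_nonneg_aux)
    show "0 \<le> z i - m" for i by (simp add: m_def)
    show "0 \<le> sum d T" if "\<forall>i\<in>T. \<forall>j\<in>UNIV - T. z j - m \<le> z i - m" for T
      using that by (intro T) (auto simp: upset_def)
  qed auto
  also have "\<dots> = (\<Sum>i\<in>UNIV. z i * d i) - m * sum d UNIV"
    by (simp add: left_diff_distrib sum_subtractf sum_distrib_left)
  finally show ?thesis using U by simp
qed

text \<open>Unlike in ordinary majorization, \<open>h\<close> is not rearranged: its partial sums are taken in the order of \<open>k\<close>.\<close>

definition ordered_majorized :: "('m::finite \<Rightarrow> real) \<Rightarrow> ('m \<Rightarrow> real) \<Rightarrow> bool" where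
  "ordered_majorized k h \<longleftrightarrow> (\<forall>T. upset k T \<longrightarrow> sum k T \<le> sum h T) \<and> sum k UNIV = sum h UNIV"

text \<open>A negative factor turns top sets into complements of top sets, and equal totals turn the
  inequality around accordingly. This covers negative exponents t.\<close>

lemma ordered_majorized_scale:
  assumes "ordered_majorized k h"
  shows "ordered_majorized (\<lambda>i. s * k i) (\<lambda>i. s * h i)"
proof -
  have "s * sum k T \<le> s * sum h T" if T: "upset (\<lambda>i. s * k i) T" for T
  proof (cases "0 \<le> s")
    case True
    show ?thesis
    proof (cases "s = 0")
      case False
      then have "upset k T" using True T by (auto simp: upset_def)
      then show ?thesis using assms True by (auto simp: ordered_majorized_def intro: mult_left_mono)
    qed simp
  next
    case False
    then have "upset k (- T)" using T by (auto simp: upset_def)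
    then have "sum k (- T) \<le> sum h (- T)" using assms by (simp add: ordered_majorized_def)
    moreover have "sum f UNIV = sum f T + sum f (- T)" for f :: "'a \<Rightarrow> real"
      using sum.subset_diff[of T UNIV f] by (simp add: Compl_eq_Diff_UNIV)
    ultimately have "sum h T \<le> sum k T" using assms by (simp add: ordered_majorized_def)
    then show ?thesis using False by (intro mult_left_mono_neg) auto
  qed
  then show ?thesis using assms by (simp add: ordered_majorized_def sum_distrib_left[symmetric])
qed

text \<open>Strict increase makes each top set of \<open>z\<close> a top set of \<open>k\<close>.
  Indices tied in \<open>k\<close> may carry different weights because top sets may cut
  ties.\<close>

lemma ordered_majorized_weighted:
  assumes "ordered_majorized k h" and z: "\<And>i j. k i < k j \<Longrightarrow> z i < z j"
  shows "(\<Sum>i\<in>UNIV. z i * k i) \<le> (\<Sum>i\<in>UNIV. z i * h i)"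
proof -
  have "0 \<le> (\<Sum>i\<in>UNIV. z i * (h i - k i))"
  proof (rule layered_sum_nonneg)
    fix T assume "upset z T"
    then have "upset k T" using z unfolding upset_def by (meson leD leI)
    then show "0 \<le> (\<Sum>i\<in>T. h i - k i)"
      using assms(1) by (simp add: ordered_majorized_def sum_subtractf)
  qed (use assms(1) in \<open>simp add: ordered_majorized_def sum_subtractf\<close>)
  then show ?thesis by (simp add: right_diff_distrib sum_subtractf)
qed

section \<open>Uniqueness of the Karcher mean\<close>

lemma spectral_conj: "unitary U \<Longrightarrow> adj U ** (U ** diagm a ** adj U) ** U = diagm a"
  using unitary_cancel(1)[of U "diagm a ** adj U ** U"] 
  by (simp add: matrix_mul_assoc[symmetric] unitary_def)

lemma conj_spectral: "unitary U \<Longrightarrow> U ** (adj U ** A ** U) ** adj U = A"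
  using unitary_cancel(2)[of U "A ** U ** adj U"]
  by (simp add: matrix_mul_assoc[symmetric] unitary_def)

lemma conj_mult:
  assumes "unitary U" shows "adj U ** (A ** B) ** U = (adj U ** A ** U) ** (adj U ** B ** U)"
  using unitary_cancel(2)[OF assms, of "B ** U"] by (simp add: matrix_mul_assoc[symmetric])

lemma mpow_half_conj:
  assumes U: "unitary U"
  shows "adj U ** mpow (U ** diagm (\<lambda>i. exp (k i)) ** adj U) (1/2) ** U = expd k"
  by (simp add: mpow_def hfun_spectral[OF U] spectral_conj[OF U] expd_def comp_def powr_def)

text \<open>In the Karcher equation of a family \<open>A\<close>, \<open>B j\<close> is the inverse of \<open>A j\<close>.\<close>

definition karcher_field :: "(nat \<Rightarrow> real) \<Rightarrow> nat \<Rightarrow> (nat \<Rightarrow> 'm::finite cmat) \<Rightarrow> 'm cmat \<Rightarrow> 'm cmat" where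
  "karcher_field w n B X = (\<Sum>j<n. w j *\<^sub>R mlog (mpow X (1/2) ** B j ** mpow X (1/2)))"

text \<open>For the family \<open>A\<close> this is the logarithm of the log-Euclidean mean, for the
  inverses its negative; it is also the Karcher field at the identity.\<close>

definition log_mean :: "(nat \<Rightarrow> real) \<Rightarrow> nat \<Rightarrow> (nat \<Rightarrow> 'm::finite cmat) \<Rightarrow> 'm cmat" where
  "log_mean w n B = (\<Sum>j<n. w j *\<^sub>R mlog (B j))"

lemma karcher_field_log_gap:
  fixes B :: "nat \<Rightarrow> 'm::finite cmat"
  assumes U: "unitary U" and X: "X = U ** diagm (\<lambda>i. exp (k i)) ** adj U"
    and B: "\<And>j. j < n \<Longrightarrow> pd (B j)" and w: "(\<Sum>j<n. w j) = 1"
  shows "Re ((adj U ** karcher_field w n B X ** U) $ i $ i) - Re ((adj U ** log_mean w n B ** U) $ i $ i) - k i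
    = (\<Sum>j<n. w j * log_gap k (adj U ** B j ** U) i)"
proof -
  have h: "hermitian X" by (simp add: X)
  have pX: "pd X" using U by (simp add: X pd_spectral_iff)
  have "adj U ** mlog (mpow X (1/2) ** B j ** mpow X (1/2)) ** U
      = mlog (expd k ** (adj U ** B j ** U) ** expd k)" if "j < n" for j
  proof -
    have "adj U ** mlog (mpow X (1/2) ** B j ** mpow X (1/2)) ** U
      = mlog (adj U ** (mpow X (1/2) ** B j ** mpow X (1/2)) ** U)"
      using pd_mpow_congruence[OF pX B[OF that], of "1/2"] U
      by (simp add: mlog_unitary_conj pd_hermitian)
    then show ?thesis by (simp only: conj_mult[OF U] X mpow_half_conj[OF U])
  qed
  then have "(adj U ** karcher_field w n B X ** U) $ i $ i
      = (\<Sum>j<n. w j *\<^sub>R mlog (expd k ** (adj U ** B j ** U) ** expd k) $ i $ i)"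
    by (simp add: karcher_field_def cmult_sum_left cmult_sum_right cmult_scaleR_left cmult_scaleR_right)
  moreover have "(adj U ** log_mean w n B ** U) $ i $ i = (\<Sum>j<n. w j *\<^sub>R mlog (adj U ** B j ** U) $ i $ i)"
    using B U by (simp add: log_mean_def cmult_sum_left cmult_sum_right cmult_scaleR_left cmult_scaleR_right
      mlog_unitary_conj pd_hermitian)
  moreover have "k i = (\<Sum>j<n. w j * k i)" using w by (simp add: sum_distrib_right[symmetric])
  ultimately show ?thesis
    by (simp add: log_gap_def right_diff_distrib sum_subtractf)
qed

text \<open>\<open>d\<close> is a weighted sum of log gaps. Positive weights exclude cancellation
  between the \<open>B j\<close>, so \<open>d = 0\<close> forces the equality case of
  \<open>log_gap_majorization\<close> for each of them.\<close>

lemma karcher_field_upset: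
  assumes U: "unitary U" and X: "X = U ** diagm (\<lambda>i. exp (k i)) ** adj U"
    and B: "\<And>j. j < n \<Longrightarrow> pd (B j)" and w: "(\<Sum>j<n. w j) = 1" "\<And>j. j < n \<Longrightarrow> 0 < w j"
  defines "d \<equiv> \<lambda>i. Re ((adj U ** karcher_field w n B X ** U) $ i $ i)
      - Re ((adj U ** log_mean w n B ** U) $ i $ i) - k i"
  shows "upset k T \<Longrightarrow> 0 \<le> sum d T" "sum d UNIV = 0"
    "(\<And>i. d i = 0) \<Longrightarrow> j < n \<Longrightarrow> B j ** (U ** diagm k ** adj U) = (U ** diagm k ** adj U) ** B j"
proof -
  let ?g = "\<lambda>j. log_gap k (adj U ** B j ** U)"
  have "d = (\<lambda>i. \<Sum>j<n. w j * ?g j i)"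
    unfolding d_def using karcher_field_log_gap[OF U X B w(1)] by simp
  then have d: "sum d T = (\<Sum>j<n. w j * sum (?g j) T)" for T
    by (simp add: sum.swap[of _ T] sum_distrib_left)
  have p: "pd (adj U ** B j ** U)" if "j < n" for j using B U that by (simp add: pd_unitary_conj)
  have nn: "0 \<le> w j * sum (?g j) T" if "upset k T" "j < n" for j T
    using log_gap_majorization[OF p[OF that(2)], of k] that w(2)[OF that(2)]
    by (intro mult_nonneg_nonneg) auto
  show "upset k T \<Longrightarrow> 0 \<le> sum d T" unfolding d using nn by (intro sum_nonneg) auto
  show "sum d UNIV = 0" unfolding d using p by (intro sum.neutral) (simp add: sum_log_gap)
  assume d0: "\<And>i. d i = 0" and j: "j < n"
  have "sum (?g j) {i. c \<le> k i} = 0" for c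
  proof -
    have up: "upset k {i. c \<le> k i}" by (auto simp: upset_def)
    have "(\<Sum>j<n. w j * sum (?g j) {i. c \<le> k i}) = 0"
      unfolding d[symmetric] using d0 by simp
    then have "w j * sum (?g j) {i. c \<le> k i} = 0"
      using nn[OF up] j by (subst (asm) sum_nonneg_eq_0_iff) auto
    then show ?thesis using w(2)[OF j] by simp
  qed
  then have "\<forall>i i'. k i \<noteq> k i' \<longrightarrow> (adj U ** B j ** U) $ i $ i' = 0"
    using log_gap_majorization[OF p[OF j], of k] by blast
  then have c: "(adj U ** B j ** U) ** diagm k = diagm k ** (adj U ** B j ** U)"
    by (simp add: commute_diagm_iff)
  have "U ** ((adj U ** B j ** U) ** diagm k) ** adj U = B j ** (U ** diagm k ** adj U)"
    using unitary_cancel(2)[OF U, of "B j ** U ** diagm k ** adj U"] by (simp add: matrix_mul_assoc[symmetric])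
  moreover have "U ** (diagm k ** (adj U ** B j ** U)) ** adj U = (U ** diagm k ** adj U) ** B j"
    using unitary_cancel(4)[OF U, of "U ** diagm k ** adj U ** B j"] by (simp add: matrix_mul_assoc)
  ultimately show "B j ** (U ** diagm k ** adj U) = (U ** diagm k ** adj U) ** B j"
    by (simp add: c)
qed

lemma pd_exp_spectral:
  assumes "pd X"
  obtains U k where "unitary U" "X = U ** diagm (\<lambda>i. exp (k i)) ** adj U"
proof -
  obtain U a where "unitary U" "X = U ** diagm a ** adj U" "\<And>i. 0 < a i"
    using pd_spectral[OF assms] by blast
  then show thesis using that[of U "\<lambda>i. ln (a i)"] by simp
qed

text \<open>Both the field and the log mean vanish, so the differences reduce to -k; weighted by
  \<open>k\<close> itself, their sum is minus the sum of the squares, yet nonnegative.\<close>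

lemma karcher_solution_identity:
  fixes B :: "nat \<Rightarrow> 'm::finite cmat"
  assumes B: "\<And>j. j < n \<Longrightarrow> pd (B j)" and w: "(\<Sum>j<n. w j) = 1" "\<And>j. j < n \<Longrightarrow> 0 < w j"
    and L: "log_mean w n B = 0" and Y: "pd Y" and K: "karcher_field w n B Y = 0"
  shows "Y = mat 1"
proof -
  obtain U k where U: "unitary U" and Yk: "Y = U ** diagm (\<lambda>i. exp (k i)) ** adj U"
    using pd_exp_spectral[OF Y] .
  note up = karcher_field_upset[where B = B and w = w and n = n, OF U Yk B w]
  have "0 \<le> (\<Sum>i\<in>UNIV. k i * (- k i))"
    using layered_sum_nonneg[of k "\<lambda>i. - k i"] up(1,2) by (simp add: L K cmult_0_left cmult_0_right)
  then have "(\<Sum>i\<in>UNIV. (k i)\<^sup>2) \<le> 0" by (simp add: power2_eq_square sum_negf)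
  then have "(\<Sum>i\<in>UNIV. (k i)\<^sup>2) = 0" by (intro antisym sum_nonneg) auto
  then have "k i = 0" for i by (simp add: sum_nonneg_eq_0_iff)
  then show ?thesis using U by (simp add: Yk diagm_one unitary_def)
qed

lemma pd_mpow_half: "pd X \<Longrightarrow> mpow X (1/2) ** mpow X (1/2) = X"
  by (simp add: mpow_mult mpow_one)

text \<open>Congruence by X^(-1/2) sends \<open>X\<close> to the identity and \<open>Y\<close> to
  \<open>Y'\<close>. The equation for \<open>X\<close> becomes \<open>log_mean w n B' = 0\<close>,
  and the one for \<open>Y\<close> survives up to a unitary conjugation.\<close>

theorem karcher_solution_unique:
  fixes B :: "nat \<Rightarrow> 'm::finite cmat"
  assumes B: "\<And>j. j < n \<Longrightarrow> pd (B j)" and w: "(\<Sum>j<n. w j) = 1" "\<And>j. j < n \<Longrightarrow> 0 < w j"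
    and X: "pd X" "karcher_field w n B X = 0" and Y: "pd Y" "karcher_field w n B Y = 0"
  shows "Y = X"
proof -
  define S where "S = mpow X (1/2)"
  define S' where "S' = mpow X (-(1/2))"
  have SS: "S ** S' = mat 1" "S' ** S = mat 1" "S ** S = X" "adj S = S" "adj S' = S'"
    using X by (simp_all add: S_def S'_def mpow_mult mpow_zero mpow_one adj_mpow)
  define B' where "B' j = S ** B j ** S" for j
  define Y' where "Y' = S' ** Y ** S'"
  have B': "pd (B' j)" if "j < n" for j
    using pd_congruence[OF B[OF that] SS(2)] by (simp add: B'_def SS)
  have Y': "pd Y'" using pd_congruence[OF Y(1) SS(1)] by (simp add: Y'_def SS)
  have YY: "S ** Y' ** S = Y"
  proof -
    have "S ** Y' ** S = (S ** S') ** Y ** (S' ** S)" by (simp only: Y'_def matrix_mul_assoc)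
    then show ?thesis by (simp add: SS)
  qed
  define R where "R = mpow Y (1/2)"
  \<comment> \<open>The factor between two square roots of \<open>Y\<close>: Y^(1/2) V (adj V)
    Y^(1/2) = X^(1/2) Y' X^(1/2) = Y, hence \<open>V\<close> is unitary.\<close>
  define V where "V = mpow Y (-(1/2)) ** (S ** mpow Y' (1/2))"
  have RR: "R ** mpow Y (-(1/2)) = mat 1" "adj R = R"
    using Y by (simp_all add: R_def mpow_mult mpow_zero adj_mpow)
  have RV: "R ** V = S ** mpow Y' (1/2)"
    by (simp add: V_def matrix_mul_assoc RR)
  have VR: "adj V ** R = mpow Y' (1/2) ** S"
    using arg_cong[OF RV, of adj] Y' by (simp add: adj_mult RR SS adj_mpow)
  have "unitary (adj V)"
  proof (rule unitaryI)
    have "R ** (V ** adj V) ** R = (R ** V) ** (adj V ** R)" by (simp only: matrix_mul_assoc)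
    also have "\<dots> = S ** (mpow Y' (1/2) ** mpow Y' (1/2)) ** S" by (simp only: RV VR matrix_mul_assoc)
    also have "\<dots> = R ** R" by (simp only: pd_mpow_half[OF Y'] YY) (simp add: R_def Y pd_mpow_half)
    finally have e: "R ** (V ** adj V) ** R = R ** R" .
    have l: "mpow Y (-(1/2)) ** R = mat 1" using Y by (simp add: R_def mpow_mult mpow_zero)
    have "mpow Y (-(1/2)) ** (R ** (V ** adj V) ** R) ** mpow Y (-(1/2)) = (mpow Y (-(1/2)) ** R) ** (V ** adj V) ** (R ** mpow Y (-(1/2)))"
      by (simp only: matrix_mul_assoc)
    moreover have "mpow Y (-(1/2)) ** (R ** R) ** mpow Y (-(1/2)) = (mpow Y (-(1/2)) ** R) ** (R ** mpow Y (-(1/2)))"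
      by (simp only: matrix_mul_assoc)
    ultimately show "adj (adj V) ** adj V = mat 1" by (simp add: e l RR)
  qed
  then have V: "unitary V" using unitary_adj by fastforce
  have "karcher_field w n B' Y' = adj V ** karcher_field w n B Y ** V"
  proof -
    have "mlog (mpow Y' (1/2) ** B' j ** mpow Y' (1/2)) = adj V ** mlog (R ** B j ** R) ** V" if "j < n" for j
    proof -
      have "mpow Y' (1/2) ** B' j ** mpow Y' (1/2) = (mpow Y' (1/2) ** S) ** B j ** (S ** mpow Y' (1/2))"
        by (simp only: B'_def matrix_mul_assoc)
      also have "\<dots> = adj V ** (R ** B j ** R) ** V" by (simp only: RV[symmetric] VR[symmetric] matrix_mul_assoc)
      finally show ?thesis
        using pd_mpow_congruence[OF Y(1) B[OF that], of "1/2"] V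
        by (simp add: mlog_unitary_conj pd_hermitian R_def)
    qed
    then show ?thesis
      by (simp add: karcher_field_def R_def cmult_sum_left cmult_sum_right cmult_scaleR_left cmult_scaleR_right)
  qed
  then have "karcher_field w n B' Y' = 0" by (simp add: Y cmult_0_left cmult_0_right)
  moreover have "log_mean w n B' = 0"
    using X(2) by (simp add: log_mean_def karcher_field_def B'_def S_def)
  ultimately have "Y' = mat 1" using karcher_solution_identity[where B = B' and w = w and n = n, OF B' w _ Y'] by simp
  then show ?thesis using YY SS by simp
qed

section \<open>Existence of the Karcher mean\<close>

lemma inner_trace: "inner A B = Re (trace (adj A ** (B::'m::finite cmat)))"
proof -
  have "inner A B = (\<Sum>i\<in>UNIV. \<Sum>j\<in>UNIV. Re (cnj (A $ i $ j) * B $ i $ j))"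
    by (simp add: inner_vec_def inner_complex_def)
  also have "\<dots> = (\<Sum>j\<in>UNIV. \<Sum>i\<in>UNIV. Re (cnj (A $ i $ j) * B $ i $ j))" by (rule sum.swap)
  finally show ?thesis by (simp add: trace_def matrix_matrix_mult_def)
qed

lemma inner_unitary:
  assumes "unitary U" "unitary V"
  shows "inner (U ** A ** V) (U ** B ** V) = inner A (B::'m::finite cmat)"
proof -
  have "adj (U ** A ** V) ** (U ** B ** V) = adj V ** (adj A ** (adj U ** (U ** B))) ** V"
    by (simp only: adj_mult matrix_mul_assoc)
  also have "\<dots> = adj V ** (adj A ** B) ** V" by (simp add: unitary_cancel(1)[OF assms(1)])
  finally have "trace (adj (U ** A ** V) ** (U ** B ** V)) = trace (V ** (adj V ** (adj A ** B)))"
    by (simp only: trace_mul_sym[of "adj V ** (adj A ** B)" V])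
  then show ?thesis using unitary_cancel(2)[OF assms(2)] by (simp add: inner_trace)
qed

lemma norm_unitary: "unitary U \<Longrightarrow> unitary V \<Longrightarrow> norm (U ** A ** V) = norm (A::'m::finite cmat)"
  by (simp add: norm_eq_sqrt_inner inner_unitary)

lemma norm_cmat_sq: "(norm (A::'m::finite cmat))\<^sup>2 = (\<Sum>i\<in>UNIV. \<Sum>j\<in>UNIV. (cmod (A $ i $ j))\<^sup>2)"
  by (simp add: power2_norm_eq_inner inner_vec_def)

lemma inner_spectral:
  assumes U: "unitary U"
  shows "inner (U ** diagm k ** adj U) V = (\<Sum>i\<in>UNIV. k i * Re ((adj U ** V ** U) $ i $ i))"
proof -
  have "inner (U ** diagm k ** adj U) V = inner (U ** diagm k ** adj U) (U ** (adj U ** V ** U) ** adj U)"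
    by (simp add: conj_spectral[OF U])
  also have "\<dots> = inner (diagm k) (adj U ** V ** U)"
    using U by (simp add: inner_unitary unitary_adj)
  also have "\<dots> = (\<Sum>i\<in>UNIV. \<Sum>j\<in>UNIV. if i = j then k i * Re ((adj U ** V ** U) $ i $ i) else 0)"
    unfolding inner_vec_def by (intro sum.cong refl) (simp add: diagm_component inner_complex_def)
  finally show ?thesis by simp
qed

text \<open>Multiplying by \<open>adj U\<close> on the left and by \<open>V\<close> on the right
  keeps the norm and turns the difference into the matrix with entries (a_i - b_j) W_ij, where W =
  adj U ** V.\<close>

lemma norm_spectral_diff:
  fixes U V :: "'m::finite cmat"
  assumes U: "unitary U" and V: "unitary V"
  shows "(norm (U ** diagm a ** adj U - V ** diagm b ** adj V))\<^sup>2
    = (\<Sum>i\<in>UNIV. \<Sum>j\<in>UNIV. (a i - b j)\<^sup>2 * (cmod ((adj U ** V) $ i $ j))\<^sup>2)"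
proof -
  have "norm (U ** diagm a ** adj U - V ** diagm b ** adj V)
      = norm (adj U ** (U ** diagm a ** adj U - V ** diagm b ** adj V) ** V)"
    using norm_unitary[OF unitary_adj[OF U] V] by simp
  also have "adj U ** (U ** diagm a ** adj U - V ** diagm b ** adj V) ** V
      = diagm a ** (adj U ** V) - (adj U ** V) ** diagm b"
    using unitary_cancel(1)[OF U, of "diagm a ** adj U ** V"]
      unitary_cancel(3)[OF V, of "adj U ** V ** diagm b"]
    by (simp add: cmult_diff_left cmult_diff_right) (simp add: matrix_mul_assoc)
  finally have "(norm (U ** diagm a ** adj U - V ** diagm b ** adj V))\<^sup>2
      = (\<Sum>i\<in>UNIV. \<Sum>j\<in>UNIV. (cmod (complex_of_real (a i - b j) * (adj U ** V) $ i $ j))\<^sup>2)"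
    by (simp add: norm_cmat_sq diagm_mult_left diagm_mult_right left_diff_distrib mult.commute)
  then show ?thesis by (simp only: norm_mult norm_of_real power_mult_distrib power2_abs)
qed

lemma hfun_lipschitz:
  fixes U V :: "'m::finite cmat"
  assumes U: "unitary U" and V: "unitary V" and L: "0 \<le> L"
    and f: "\<And>i j. \<bar>f (a i) - f (b j)\<bar> \<le> L * \<bar>a i - b j\<bar>"
  shows "norm (hfun f (U ** diagm a ** adj U) - hfun f (V ** diagm b ** adj V))
    \<le> L * norm (U ** diagm a ** adj U - V ** diagm b ** adj V)"
proof -
  have "(f (a i) - f (b j))\<^sup>2 \<le> L\<^sup>2 * (a i - b j)\<^sup>2" for i j
    using power_mono[OF f[of i j], of 2] by (simp add: power_mult_distrib)
  then have "(norm (hfun f (U ** diagm a ** adj U) - hfun f (V ** diagm b ** adj V)))\<^sup>2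
      \<le> (L * norm (U ** diagm a ** adj U - V ** diagm b ** adj V))\<^sup>2"
    unfolding power_mult_distrib hfun_spectral[OF U] hfun_spectral[OF V] norm_spectral_diff[OF U V]
    by (auto simp: sum_distrib_left mult.assoc[symmetric] intro!: sum_mono mult_right_mono)
  then show ?thesis by (rule power2_le_imp_le) (simp add: L)
qed

text \<open>Were a_i farther from every b_j than the norm, row i of
  \<open>norm_spectral_diff\<close> alone would exceed the squared norm, its weights summing to
  one.\<close>

lemma spectrum_perturbation:
  fixes U V :: "'m::finite cmat"
  assumes U: "unitary U" and V: "unitary V"
  shows "\<exists>j. \<bar>a i - b j\<bar> \<le> norm (U ** diagm a ** adj U - V ** diagm b ** adj V)"
proof (rule ccontr)
  let ?r = "norm (U ** diagm a ** adj U - V ** diagm b ** adj V)"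
  let ?W = "\<lambda>i j. (cmod ((adj U ** V) $ i $ j))\<^sup>2"
  assume "\<not> (\<exists>j. \<bar>a i - b j\<bar> \<le> ?r)"
  then have gt: "?r\<^sup>2 < (a i - b j)\<^sup>2" for j
    by (metis abs_ge_zero linorder_not_le norm_ge_zero power2_abs power_strict_mono zero_less_numeral)
  have one: "(\<Sum>j\<in>UNIV. ?W i j) = 1"
    using U V by (intro unitary_row_norm unitary_mult unitary_adj)
  then obtain j0 where j0: "0 < ?W i j0"
    by (metis (no_types, lifting) sum_nonpos not_less not_one_le_zero)
  have "?r\<^sup>2 = (\<Sum>j\<in>UNIV. ?r\<^sup>2 * ?W i j)" using one by (simp add: sum_distrib_left[symmetric])
  also have "\<dots> < (\<Sum>j\<in>UNIV. (a i - b j)\<^sup>2 * ?W i j)"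
  proof (rule sum_strict_mono_ex1)
    show "\<forall>j\<in>UNIV. ?r\<^sup>2 * ?W i j \<le> (a i - b j)\<^sup>2 * ?W i j"
      using gt by (intro ballI mult_right_mono) (auto intro: less_imp_le)
    show "\<exists>j\<in>UNIV. ?r\<^sup>2 * ?W i j < (a i - b j)\<^sup>2 * ?W i j"
      using mult_strict_right_mono[OF gt j0] by blast
  qed simp
  also have "\<dots> \<le> (\<Sum>i\<in>UNIV. \<Sum>j\<in>UNIV. (a i - b j)\<^sup>2 * ?W i j)"
    by (rule member_le_sum) (auto intro!: sum_nonneg)
  also have "\<dots> = ?r\<^sup>2" by (simp add: norm_spectral_diff[OF U V])
  finally show False by simp
qed

lemma exp_lipschitz:
  assumes "x \<le> M" "y \<le> (M::real)" shows "\<bar>exp x - exp y\<bar> \<le> exp M * \<bar>x - y\<bar>"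
proof -
  have "exp x - exp y \<le> exp M * (x - y)" if "y \<le> x" "x \<le> M" for x y :: real
  proof -
    have "exp x - exp y = exp x * (1 - exp (y - x))" by (simp add: exp_diff field_simps)
    also have "\<dots> \<le> exp x * (x - y)" using exp_ge_add_one_self[of "y - x"] by (intro mult_left_mono) (linarith, simp)
    also have "\<dots> \<le> exp M * (x - y)" using that by (intro mult_right_mono) auto
    finally show ?thesis .
  qed
  from this[of x y] this[of y x] show ?thesis using assms by (cases "y \<le> x") (auto simp: abs_if)
qed

lemma ln_lipschitz:
  assumes "0 < e" "e \<le> x" "e \<le> (y::real)" shows "\<bar>ln x - ln y\<bar> \<le> 1 / e * \<bar>x - y\<bar>"
proof -
  have "ln x - ln y \<le> 1 / e * (x - y)" if "y \<le> x" "e \<le> y" for x y :: real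
  proof -
    have "ln x - ln y \<le> (x - y) / y" using that assms(1) by (intro ln_diff_le) auto
    also have "\<dots> \<le> (x - y) / e" using that assms(1) by (intro divide_left_mono) auto
    finally show ?thesis by simp
  qed
  from this[of x y] this[of y x] show ?thesis using assms
    by (cases "y \<le> x") (auto simp: abs_if ln_less_cancel_iff)
qed

text \<open>The condition on \<open>f\<close> compares a point near one eigenvalue with every
  eigenvalue, because \<open>hfun_lipschitz\<close> needs all pairs;
  \<open>spectrum_perturbation\<close> brings the eigenvalues of a nearby matrix within
  \<open>r\<close>.\<close>

lemma continuous_on_hfun:
  fixes S :: "'m::finite cmat set"
  assumes h: "\<And>A. A \<in> S \<Longrightarrow> hermitian A"
    and f: "\<And>V b. unitary V \<Longrightarrow> V ** diagm b ** adj V \<in> S \<Longrightarrow> \<exists>r>0. \<exists>L\<ge>0. \<forall>j j'. \<forall>x.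
      \<bar>x - b j\<bar> \<le> r \<longrightarrow> \<bar>f x - f (b j')\<bar> \<le> L * \<bar>x - b j'\<bar>"
  shows "continuous_on S (hfun f)"
  unfolding continuous_on_iff
proof (intro ballI allI impI)
  fix A and e :: real assume A: "A \<in> S" and e: "0 < e"
  obtain V b where V: "unitary V" and Ab: "A = V ** diagm b ** adj V" using spectral[OF h[OF A]] .
  obtain r L where r: "0 < r" and L: "0 \<le> L"
    and lip: "\<And>j j' x. \<bar>x - b j\<bar> \<le> r \<Longrightarrow> \<bar>f x - f (b j')\<bar> \<le> L * \<bar>x - b j'\<bar>"
    using f[OF V A[unfolded Ab]] by blast
  define d where "d = min r (e / (L + 1))"
  have d: "0 < d" using r e L by (simp add: d_def)
  have "dist (hfun f B) (hfun f A) < e" if B: "B \<in> S" "dist B A < d" for B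
  proof -
    obtain U a where U: "unitary U" and Ba: "B = U ** diagm a ** adj U" using spectral[OF h[OF B(1)]] .
    have BA: "norm (B - A) < d" using B(2) by (simp add: dist_norm)
    have "\<bar>f (a i) - f (b j')\<bar> \<le> L * \<bar>a i - b j'\<bar>" for i j'
    proof -
      obtain j where "\<bar>a i - b j\<bar> \<le> norm (B - A)"
        using spectrum_perturbation[OF U V] unfolding Ab Ba by blast
      then show ?thesis using BA by (intro lip[of _ j]) (auto simp: d_def)
    qed
    then have "norm (hfun f B - hfun f A) \<le> L * norm (B - A)"
      unfolding Ab Ba by (intro hfun_lipschitz U V L)
    also have "\<dots> \<le> (L + 1) * norm (B - A)" by (simp add: mult_right_mono)
    also have "\<dots> < (L + 1) * (e / (L + 1))"
      using BA L by (intro mult_strict_left_mono) (auto simp: d_def)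
    also have "\<dots> = e" using L by simp
    finally show ?thesis by (simp add: dist_norm)
  qed
  then show "\<exists>d>0. \<forall>B\<in>S. dist B A < d \<longrightarrow> dist (hfun f B) (hfun f A) < e" using d by blast
qed

lemma continuous_on_mexp: "continuous_on {A::'m::finite cmat. hermitian A} mexp"
  unfolding mexp_def
proof (rule continuous_on_hfun)
  fix V :: "'m cmat" and b :: "'m \<Rightarrow> real"
  define M where "M = Max (range b)"
  have "b j \<le> M" for j by (simp add: M_def)
  then have "\<bar>exp x - exp (b j')\<bar> \<le> exp (M + 1) * \<bar>x - b j'\<bar>" if "\<bar>x - b j\<bar> \<le> 1" for x j j'
    using that by (intro exp_lipschitz) (smt (verit, best))+
  then show "\<exists>r>0. \<exists>L\<ge>0. \<forall>j j' x. \<bar>x - b j\<bar> \<le> r \<longrightarrow> \<bar>exp x - exp (b j')\<bar> \<le> L * \<bar>x - b j'\<bar>"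
    by (intro exI[of _ 1] exI[of _ "exp (M + 1)"] conjI) auto
qed auto

lemma continuous_on_mlog: "continuous_on {A::'m::finite cmat. pd A} mlog"
  unfolding mlog_def
proof (rule continuous_on_hfun)
  fix V :: "'m cmat" and b :: "'m \<Rightarrow> real" assume V: "unitary V" "V ** diagm b ** adj V \<in> {A. pd A}"
  then have b0: "0 < b j" for j by (simp add: pd_spectral_iff)
  define m where "m = Min (range b)"
  have "m \<in> range b" unfolding m_def by (rule Min_in) auto
  then have m0: "0 < m" using b0 by auto
  have bm: "m \<le> b j" for j by (simp add: m_def)
  \<comment> \<open>Half of the least eigenvalue keeps \<open>x\<close> away from 0, where the
    logarithm is not Lipschitz.\<close>
  have "\<bar>ln x - ln (b j')\<bar> \<le> 1 / (m / 2) * \<bar>x - b j'\<bar>" if "\<bar>x - b j\<bar> \<le> m / 2" for x j j'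
    using that m0 bm[of j] bm[of j'] by (intro ln_lipschitz) linarith+
  then show "\<exists>r>0. \<exists>L\<ge>0. \<forall>j j' x. \<bar>x - b j\<bar> \<le> r \<longrightarrow> \<bar>ln x - ln (b j')\<bar> \<le> L * \<bar>x - b j'\<bar>"
    using m0 by (intro exI[of _ "m / 2"] exI[of _ "1 / (m / 2)"] conjI) auto
qed (simp add: pd_hermitian)

lemma continuous_on_cmult:
  fixes f g :: "'a::topological_space \<Rightarrow> 'm::finite cmat"
  assumes "continuous_on S f" "continuous_on S g"
  shows "continuous_on S (\<lambda>x. f x ** g x)"
  unfolding matrix_matrix_mult_def using assms by (intro continuous_intros)

section \<open>The Karcher field on Hermitian matrices\<close>

lemma subspace_hermitian: "subspace {A. hermitian A}"
  by (auto simp: subspace_def hermitian_def adj_add adj_scaleR) (simp add: vec_eq_iff)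

lemma hermitian_karcher_field:
  assumes "pd X" "\<And>j. j < n \<Longrightarrow> pd (B j)"
  shows "hermitian (karcher_field w n B X)"
  unfolding karcher_field_def
  using assms by (intro hermitian_sum hermitian_scaleR hermitian_mlog pd_mpow_congruence) auto

text \<open>Weighting the differences in \<open>karcher_field_upset\<close> by \<open>k\<close>
  gives this coercivity: the field points outwards once the norm of \<open>K\<close> exceeds that of
  the log mean.\<close>

lemma inner_karcher_field_ge:
  fixes B :: "nat \<Rightarrow> 'm::finite cmat"
  assumes B: "\<And>j. j < n \<Longrightarrow> pd (B j)" and w: "(\<Sum>j<n. w j) = 1" "\<And>j. j < n \<Longrightarrow> 0 < w j"
    and K: "hermitian K"
  shows "inner K (log_mean w n B) + (norm K)\<^sup>2 \<le> inner K (karcher_field w n B (mexp K))"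
proof -
  obtain U k where U: "unitary U" and Kk: "K = U ** diagm k ** adj U" using spectral[OF K] .
  have X: "mexp K = U ** diagm (\<lambda>i. exp (k i)) ** adj U"
    by (simp add: Kk mexp_def hfun_spectral[OF U] comp_def)
  note up = karcher_field_upset[where B = B and w = w and n = n, OF U X B w]
  have "(norm K)\<^sup>2 = (\<Sum>i\<in>UNIV. k i * k i)"
    unfolding power2_norm_eq_inner
    by (subst (1) Kk, subst inner_spectral[OF U]) (simp add: Kk spectral_conj[OF U] diagm_component)
  moreover have "inner K V = (\<Sum>i\<in>UNIV. k i * Re ((adj U ** V ** U) $ i $ i))" for V
    unfolding Kk by (rule inner_spectral[OF U])
  moreover have "0 \<le> (\<Sum>i\<in>UNIV. k i * (Re ((adj U ** karcher_field w n B (mexp K) ** U) $ i $ i)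
      - Re ((adj U ** log_mean w n B ** U) $ i $ i) - k i))"
    by (rule layered_sum_nonneg[OF up(1,2)])
  ultimately show ?thesis by (simp add: right_diff_distrib sum_subtractf)
qed

theorem karcher_solution_exists:
  fixes B :: "nat \<Rightarrow> 'm::finite cmat"
  assumes B: "\<And>j. j < n \<Longrightarrow> pd (B j)" and w: "(\<Sum>j<n. w j) = 1" "\<And>j. j < n \<Longrightarrow> 0 < w j"
  shows "\<exists>X. pd X \<and> karcher_field w n B X = 0"
proof -
  define L where "L = log_mean w n B"
  \<comment> \<open>The margin 1 leaves room for a step of length at most 1 from a point of norm at
    most \<open>norm L\<close>.\<close>
  define R where "R = norm L + 1"
  define S where "S = {K::'m cmat. hermitian K} \<inter> cball 0 R"
  define F where "F K = - karcher_field w n B (mexp K)" for K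
  have S: "compact S" "convex S" "0 \<in> S"
  proof -
    show "compact S" unfolding S_def
      by (intro closed_Int_compact closed_subspace subspace_hermitian) auto
    show "convex S" unfolding S_def
      by (intro convex_Int subspace_imp_convex[OF subspace_hermitian] convex_cball)
    show "0 \<in> S" using subspace_0[OF subspace_hermitian] by (auto simp: S_def R_def)
  qed
  have cont: "continuous_on S F"
  proof -
    have e: "continuous_on S (\<lambda>K. mexp ((1/2) *\<^sub>R K))"
      by (rule continuous_on_compose2[OF continuous_on_mexp])
         (auto intro!: continuous_intros simp: S_def hermitian_scaleR)
    have "continuous_on S (\<lambda>K. mlog (mexp ((1/2) *\<^sub>R K) ** B j ** mexp ((1/2) *\<^sub>R K)))" if "j < n" for j
    proof (rule continuous_on_compose2[OF continuous_on_mlog])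
      show "continuous_on S (\<lambda>K. mexp ((1/2) *\<^sub>R K) ** B j ** mexp ((1/2) *\<^sub>R K))"
        by (intro continuous_on_cmult e continuous_on_const)
      show "(\<lambda>K. mexp ((1/2) *\<^sub>R K) ** B j ** mexp ((1/2) *\<^sub>R K)) ` S \<subseteq> {A. pd A}"
        using pd_mpow_congruence[OF pd_mexp B[OF that], of _ "1/2"]
        by (auto simp: S_def mpow_mexp)
    qed
    then have "continuous_on S (\<lambda>K. - (\<Sum>j<n. w j *\<^sub>R mlog (mexp ((1/2) *\<^sub>R K) ** B j ** mexp ((1/2) *\<^sub>R K))))"
      by (intro continuous_intros) auto
    then show ?thesis
      by (rule continuous_on_eq) (simp add: F_def karcher_field_def S_def mpow_mexp)
  qed
  have "continuous_on S (\<lambda>K. closest_point S (K + F K))"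
    using S by (intro continuous_on_compose2[OF continuous_on_closest_point[of S UNIV]] continuous_intros cont)
      (auto simp: compact_imp_closed)
  then obtain K where K: "K \<in> S" and fixK: "closest_point S (K + F K) = K"
    using brouwer[of S "\<lambda>K. closest_point S (K + F K)"] S closest_point_in_set[of S]
    by (auto simp: compact_imp_closed)
  \<comment> \<open>A fixed point of the projected map solves a variational inequality. Testing it
    with 0 bounds \<open>norm K\<close> by \<open>norm L\<close>, so \<open>K\<close> is interior;
    testing it with a short step along \<open>F K\<close> gives \<open>F K = 0\<close>.\<close>
  have vi: "inner (F K) (Y - K) \<le> 0" if "Y \<in> S" for Y
    using closest_point_dot[OF S(2) compact_imp_closed[OF S(1)] that, of "K + F K"] by (simp add: fixK)
  have hK: "hermitian K" using K by (simp add: S_def)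
  have "0 \<le> inner K (F K)" using vi[OF S(3)] by (simp add: inner_commute)
  then have "(norm K)\<^sup>2 \<le> - inner K L"
    using inner_karcher_field_ge[where B = B and w = w and n = n, OF B w hK] by (simp add: F_def L_def)
  also have "\<dots> \<le> norm K * norm L" using Cauchy_Schwarz_ineq2[of K L] by linarith
  finally have nK: "norm K \<le> norm L"
    by (cases "norm K = 0") (auto simp: power2_eq_square)
  define e where "e = 1 / (1 + norm (F K))"
  have e: "0 < e" "e * norm (F K) \<le> 1" by (auto simp: e_def add_pos_nonneg)
  have hF: "hermitian (F K)"
    using subspace_neg[OF subspace_hermitian]
      hermitian_karcher_field[where B = B and w = w and n = n, OF pd_mexp[OF hK] B]
    by (auto simp: F_def)
  have "K + e *\<^sub>R F K \<in> S"
  proof -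
    have "norm (K + e *\<^sub>R F K) \<le> norm K + e * norm (F K)"
      using norm_triangle_ineq[of K "e *\<^sub>R F K"] e(1) by simp
    then have "norm (K + e *\<^sub>R F K) \<le> R" using nK e(2) by (simp add: R_def)
    moreover have "hermitian (K + e *\<^sub>R F K)"
      using hK hF by (simp add: hermitian_def adj_add adj_scaleR)
    ultimately show ?thesis by (simp add: S_def)
  qed
  from vi[OF this] have "e * inner (F K) (F K) \<le> 0" by simp
  then have "inner (F K) (F K) \<le> 0" using e(1) by (simp add: mult_le_0_iff)
  then have "F K = 0" using inner_ge_zero[of "F K"] by simp
  then show ?thesis using pd_mexp[OF hK] by (auto simp: F_def)
qed

section \<open>Strictly increasing unitarily invariant norms\<close>

lemma unitarily_invariantD:
  assumes "unitarily_invariant N"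
  shows "N (r *\<^sub>R X) = \<bar>r\<bar> * N X" "N (X + Y) \<le> N X + N Y" "0 \<le> N X" "N X = 0 \<longleftrightarrow> X = 0"
    "unitary U \<Longrightarrow> unitary V \<Longrightarrow> N (U ** X ** V) = N X"
proof -
  have "N (\<chi> a b. complex_of_real r * X $ a $ b) = cmod (complex_of_real r) * N X"
    using assms unfolding unitarily_invariant_def matrix_norm_def by blast
  then show "N (r *\<^sub>R X) = \<bar>r\<bar> * N X" by (simp add: cmat_scaleR)
qed (use assms in \<open>simp_all add: unitarily_invariant_def matrix_norm_def\<close>)

lemma psd_diagm: "(\<And>i. 0 \<le> d i) \<Longrightarrow> psd (diagm d)"
  by (simp add: psd_def Re_qform inner_diagm sum_nonneg)

lemma unitary_reflection: "unitary (diagm (\<lambda>p. if p = i then -1 else 1))"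
  by (rule unitaryI) (simp add: diagm_diagm diagm_one if_distrib cong: if_cong)

text \<open>Hahn-Banach for the norm x -> N(diagm x), by separating \<open>a\<close> from the open
  ball that has it on its boundary.\<close>

lemma norming_weights_exist:
  fixes N :: "'m::finite cmat \<Rightarrow> real"
  assumes N: "unitarily_invariant N" and a: "a \<noteq> (\<lambda>_. 0)"
  shows "\<exists>y. (\<forall>x. (\<Sum>i\<in>UNIV. y i * x i) \<le> N (diagm x)) \<and> (\<Sum>i\<in>UNIV. y i * a i) = N (diagm a)"
proof -
  note D = unitarily_invariantD[OF N]
  define f where "f v = N (diagm (\<lambda>i. v $ i))" for v :: "real^'m"
  define v where "v = (\<chi> i. a i)"
  have f: "f (x + y) \<le> f x + f y" "f (r *\<^sub>R x) = \<bar>r\<bar> * f x" "0 \<le> f x" for x y r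
    using D(1)[of r "diagm (\<lambda>i. x $ i)"] D(2)[of "diagm (\<lambda>i. x $ i)" "diagm (\<lambda>i. y $ i)"] D(3)
    by (simp_all add: f_def diagm_add diagm_scaleR)
  have f0: "0 < f x" if "x \<noteq> 0" for x
  proof -
    have "(\<lambda>i. x $ i) \<noteq> (\<lambda>_. 0)" using that by (auto simp: vec_eq_iff fun_eq_iff)
    then have "diagm (\<lambda>i. x $ i) \<noteq> (diagm (\<lambda>_. 0) :: 'm cmat)" by (simp only: diagm_inject not_False_eq_True)
    moreover have "diagm (\<lambda>_. 0) = (0::'m cmat)" by (simp add: vec_eq_iff diagm_component)
    ultimately show ?thesis using D(3,4) f(3)[of x] by (simp add: f_def less_le)
  qed
  have v0: "0 < f v" using a by (intro f0) (auto simp: v_def vec_eq_iff fun_eq_iff)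
  define S where "S = {x. f x < f v}"
  have "convex S"
    unfolding convex_def
  proof (intro ballI allI impI)
    fix x y and s t :: real assume "x \<in> S" "y \<in> S" and st: "0 \<le> s" "0 \<le> t" "s + t = 1"
    then have "s * f x + t * f y < f v" by (intro convex_bound_lt) (auto simp: S_def)
    moreover have "f (s *\<^sub>R x + t *\<^sub>R y) \<le> s * f x + t * f y"
      using f(1)[of "s *\<^sub>R x" "t *\<^sub>R y"] st by (simp add: f(2))
    ultimately show "s *\<^sub>R x + t *\<^sub>R y \<in> S" by (simp add: S_def)
  qed
  moreover have "0 \<in> S" using f(2)[of 0 0] v0 by (simp add: S_def)
  moreover have "S \<inter> {v} = {}" by (simp add: S_def)
  ultimately obtain p b where p: "p \<noteq> 0" "\<And>x. x \<in> S \<Longrightarrow> inner p x \<le> b" "b \<le> inner p v"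
    using separating_hyperplane_sets[of S "{v}"] by blast
  then have le: "inner p x \<le> inner p v" if "f x < f v" for x
    using that by (force simp: S_def)
  \<comment> \<open>Testing the separation with a short multiple of \<open>p\<close> shows
    \<open>c > 0\<close>, so that the functional can be normalized.\<close>
  define c where "c = inner p v"
  have c: "0 < c"
  proof -
    have fp: "0 < f p" by (rule f0[OF p(1)])
    have "inner p ((f v / (2 * f p)) *\<^sub>R p) \<le> c"
      unfolding c_def using v0 fp by (intro le) (simp add: f(2) abs_of_pos)
    moreover have "0 < (f v / (2 * f p)) * inner p p" using p(1) fp v0 by simp
    ultimately show ?thesis by simp
  qed
  \<comment> \<open>Any r > f x scales \<open>x\<close> into the ball; approaching f x from above
    avoids dividing by f x, which may be 0.\<close>
  have bound: "inner p x * f v / c \<le> f x" for x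
  proof (rule dense_ge)
    fix r assume r: "f x < r"
    then have r0: "0 < r" using f(3)[of x] by linarith
    have "f ((f v / r) *\<^sub>R x) < f v"
    proof -
      have "f v * f x < f v * r" using r v0 by simp
      then show ?thesis using r0 v0 by (simp add: f(2) abs_of_pos divide_less_eq)
    qed
    from le[OF this] have "f v / r * inner p x \<le> c" by (simp add: c_def)
    then show "inner p x * f v / c \<le> r" using r0 c by (simp add: field_simps)
  qed
  define y where "y i = p $ i * f v / c" for i
  have y: "(\<Sum>i\<in>UNIV. y i * x i) = inner p (\<chi> i. x i) * f v / c" for x
    by (simp add: y_def inner_vec_def sum_divide_distrib sum_distrib_right sum_distrib_left mult_ac)
  show ?thesis
  proof (intro exI[of _ y] conjI allI)
    show "(\<Sum>i\<in>UNIV. y i * x i) \<le> N (diagm x)" for x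
      unfolding y using bound[of "\<chi> i. x i"] by (simp add: f_def)
    show "(\<Sum>i\<in>UNIV. y i * a i) = N (diagm a)"
      unfolding y using c by (simp add: c_def v_def) (simp add: f_def)
  qed
qed

lemma norm_diagm_permute:
  fixes N :: "'m::finite cmat \<Rightarrow> real"
  assumes N: "unitarily_invariant N" and s: "inj s"
  shows "N (diagm (a \<circ> s)) = N (diagm a)"
proof -
  define P :: "'m cmat" where "P = (\<chi> p q. if s p = q then 1 else 0)"
  have comp: "(P ** diagm d ** adj P) $ p $ q = diagm (d \<circ> s) $ p $ q" for d p q
  proof -
    have "(P ** diagm d ** adj P) $ p $ q
        = (\<Sum>r\<in>UNIV. if s p = r then complex_of_real (d r) * (if s q = r then 1 else 0) else 0)"
      unfolding spectral_component by (intro sum.cong) (auto simp: P_def)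
    also have "\<dots> = diagm (d \<circ> s) $ p $ q" using s by (auto simp: diagm_component inj_def)
    finally show ?thesis .
  qed
  have "P ** diagm (\<lambda>_. 1) ** adj P = diagm (\<lambda>_. 1)"
    using comp[of "\<lambda>_. 1"] by (simp add: vec_eq_iff comp_def)
  then have "unitary (adj P)" by (intro unitaryI) (simp add: diagm_one)
  then have "unitary P" using unitary_adj by fastforce
  moreover have "P ** diagm a ** adj P = diagm (a \<circ> s)"
    using comp[of a] by (simp add: vec_eq_iff)
  ultimately show ?thesis
    using unitarily_invariantD(5)[OF N, of P "adj P" "diagm a"] \<open>unitary (adj P)\<close> by simp
qed

text \<open>Deleting the entry a_i lowers the norm strictly, which makes y_i positive. Exchanging
  two entries leaves the norm unchanged, which orders the weights like \<open>a\<close>.\<close>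

lemma norming_weights:
  fixes N :: "'m::finite cmat \<Rightarrow> real"
  assumes N: "unitarily_invariant N" "strictly_increasing N" and a: "\<And>i. 0 < a i"
  obtains y where "\<And>x. (\<Sum>i\<in>UNIV. y i * x i) \<le> N (diagm x)" "(\<Sum>i\<in>UNIV. y i * a i) = N (diagm a)"
    "\<And>i. 0 < y i" "\<And>i j. a i < a j \<Longrightarrow> y i \<le> y j"
proof -
  note D = unitarily_invariantD[OF N(1)]
  have "a \<noteq> (\<lambda>_. 0)" using a by (metis less_irrefl)
  then obtain y where y: "\<And>x. (\<Sum>i\<in>UNIV. y i * x i) \<le> N (diagm x)" "(\<Sum>i\<in>UNIV. y i * a i) = N (diagm a)"
    using norming_weights_exist[OF N(1)] by blast
  have pos: "0 < y i" for i
  proof -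
    define b where "b p = (if p = i then 0 else a p)" for p
    let ?R = "diagm (\<lambda>p. if p = i then -1 else 1) :: 'm cmat"
    \<comment> \<open>Averaging with a reflected copy deletes the entry and cannot raise the
      norm.\<close>
    have "diagm b = (1/2) *\<^sub>R (diagm a + ?R ** diagm a ** mat 1)"
      by (simp add: diagm_diagm diagm_add diagm_scaleR diagm_inject fun_eq_iff b_def)
    then have "N (diagm b) \<le> (1/2) * (N (diagm a) + N (?R ** diagm a ** mat 1))"
      using D(1)[of "1/2" "diagm a + ?R ** diagm a ** mat 1"] D(2)[of "diagm a" "?R ** diagm a ** mat 1"] by simp
    also have "N (?R ** diagm a ** mat 1) = N (diagm a)" by (intro D(5) unitary_reflection unitary_mat1)
    finally have "N (diagm b) \<le> N (diagm a)" by simp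
    moreover have "N (diagm b) \<noteq> N (diagm a)"
    proof
      assume "N (diagm b) = N (diagm a)"
      moreover have "psd (diagm b)" "psd (diagm a - diagm b)"
        using a by (auto intro!: psd_diagm simp: diagm_diff b_def less_imp_le)
      ultimately have "diagm b = diagm a" using N(2) unfolding strictly_increasing_def by blast
      then have "b i = a i" by (simp add: diagm_inject)
      then show False using a[of i] by (simp add: b_def)
    qed
    ultimately have "(\<Sum>p\<in>UNIV. y p * b p) < (\<Sum>p\<in>UNIV. y p * a p)"
      using y(1)[of b] y(2) by linarith
    then have "0 < (\<Sum>p\<in>UNIV. y p * a p - y p * b p)" by (simp add: sum_subtractf)
    also have "\<dots> = (\<Sum>p\<in>UNIV. if p = i then y p * a p else 0)"
      by (intro sum.cong) (auto simp: b_def)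
    finally have "0 < y i * a i" by simp
    then show ?thesis using a[of i] by (simp add: zero_less_mult_iff)
  qed
  have ord: "y i \<le> y j" if "a i < a j" for i j
  proof -
    define s where "s = Transposition.transpose i j"
    have "(\<Sum>p\<in>UNIV. y p * (a \<circ> s) p) \<le> (\<Sum>p\<in>UNIV. y p * a p)"
      using y(1)[of "a \<circ> s"] norm_diagm_permute[OF N(1), of s a] y(2) by (simp add: s_def)
    then have "0 \<le> (\<Sum>p\<in>UNIV. y p * (a p - a (s p)))"
      by (simp add: right_diff_distrib sum_subtractf)
    also have "\<dots> = (\<Sum>p\<in>{i, j}. y p * (a p - a (s p)))"
      by (intro sum.mono_neutral_right) (auto simp: s_def transpose_def)
    also have "\<dots> = (y j - y i) * (a j - a i)"
      using that by (subst sum.insert) (auto simp: s_def algebra_simps)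
    finally show ?thesis using that by (simp add: zero_le_mult_iff)
  qed
  show thesis by (rule that[OF y pos ord])
qed

text \<open>Averaging with the reflection at i clears row and column i off the diagonal without
  raising the norm; \<open>P F\<close> is the stage at which the indices in \<open>F\<close> are
  done.\<close>

lemma norm_pinching:
  fixes X :: "'m::finite cmat"
  assumes N: "unitarily_invariant N" and X: "hermitian X"
  shows "N (diagm (\<lambda>i. Re (X $ i $ i))) \<le> N X"
proof -
  note D = unitarily_invariantD[OF N]
  define P where "P F = (\<chi> p q. if p = q \<or> (p \<notin> F \<and> q \<notin> F) then X $ p $ q else 0)" for F :: "'m set"
  have "N (P F) \<le> N X" if "finite F" for F
    using that
  proof induction
    case empty
    have "P {} = X" by (simp add: P_def vec_eq_iff)
    then show ?case by simp
  next
    case (insert i F)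
    let ?R = "diagm (\<lambda>p. if p = i then -1 else 1) :: 'm cmat"
    have "P (insert i F) = (1/2) *\<^sub>R (P F + ?R ** P F ** ?R)"
      by (auto simp: vec_eq_iff P_def diagm_mult_left diagm_mult_right)
    then have "N (P (insert i F)) \<le> (1/2) * (N (P F) + N (?R ** P F ** ?R))"
      using D(1)[of "1/2" "P F + ?R ** P F ** ?R"] D(2)[of "P F" "?R ** P F ** ?R"] by simp
    also have "N (?R ** P F ** ?R) = N (P F)" by (intro D(5) unitary_reflection)
    finally show ?case using insert.IH by simp
  qed
  moreover have "P UNIV = diagm (\<lambda>i. Re (X $ i $ i))"
    using hermitian_diag_real[OF X] by (auto simp: P_def vec_eq_iff diagm_component)
  ultimately show ?thesis by (metis finite)
qed

section \<open>Convexity of the exponential and rigidity of the norm\<close>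

lemma exp_tangent:
  fixes x y :: real
  shows "exp x + exp x * (y - x) \<le> exp y" and "exp y = exp x + exp x * (y - x) \<Longrightarrow> y = x"
proof -
  have e: "exp y = exp x * exp (y - x)" by (simp add: exp_add[symmetric])
  have "exp x * (1 + (y - x)) \<le> exp x * exp (y - x)" by (intro mult_left_mono exp_ge_add_one_self) simp
  then show "exp x + exp x * (y - x) \<le> exp y" by (simp add: e distrib_left)
  assume "exp y = exp x + exp x * (y - x)"
  then have "exp x * exp (y - x) = exp x * (1 + (y - x))" by (simp add: e distrib_left)
  then have "exp (y - x) = 1 + (y - x)" by (subst (asm) mult_cancel_left) simp
  then have "ln (exp (y - x)) = exp (y - x) - 1" unfolding ln_exp by linarith
  then have "exp (y - x) = 1" by (rule ln_eq_minus_one[rotated]) simp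
  then show "y = x" by simp
qed

text \<open>Jensen's inequality for the spectral weights of row i. Equality puts all weight on
  eigenvalues equal to \<open>h\<close>, so the i-th coordinate vector is an eigenvector of
  \<open>H\<close>.\<close>

lemma mexp_diag:
  fixes H :: "'m::finite cmat"
  assumes H: "hermitian H"
  shows "exp (Re (H $ i $ i)) \<le> Re (mexp H $ i $ i)"
    and "Re (mexp H $ i $ i) = exp (Re (H $ i $ i)) \<Longrightarrow> j \<noteq> i \<Longrightarrow> H $ j $ i = 0"
proof -
  obtain V q where V: "unitary V" and Hq: "H = V ** diagm q ** adj V" using spectral[OF H] .
  define h where "h = Re (H $ i $ i)"
  let ?c = "\<lambda>p. (cmod (V $ i $ p))\<^sup>2"
  have one: "(\<Sum>p\<in>UNIV. ?c p) = 1" by (rule unitary_row_norm[OF V])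
  have h: "h = (\<Sum>p\<in>UNIV. ?c p * q p)" by (simp add: h_def Hq spectral_diag)
  have E: "Re (mexp H $ i $ i) = (\<Sum>p\<in>UNIV. ?c p * exp (q p))"
    by (simp add: mexp_def Hq hfun_spectral[OF V] spectral_diag)
  have "(\<Sum>p\<in>UNIV. ?c p * (exp h + exp h * (q p - h))) = exp h * (\<Sum>p\<in>UNIV. ?c p)
      + exp h * (\<Sum>p\<in>UNIV. ?c p * q p) - exp h * h * (\<Sum>p\<in>UNIV. ?c p)"
    unfolding sum_distrib_left by (simp add: sum.distrib[symmetric] sum_subtractf[symmetric] algebra_simps)
  then have L: "(\<Sum>p\<in>UNIV. ?c p * (exp h + exp h * (q p - h))) = exp h"
    by (simp only: h[symmetric] one)
  have le: "?c p * (exp h + exp h * (q p - h)) \<le> ?c p * exp (q p)" for p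
    by (intro mult_left_mono exp_tangent) simp
  have "(\<Sum>p\<in>UNIV. ?c p * (exp h + exp h * (q p - h))) \<le> (\<Sum>p\<in>UNIV. ?c p * exp (q p))"
    by (rule sum_mono[OF le])
  then have "exp h \<le> Re (mexp H $ i $ i)" by (simp only: L E)
  then show "exp (Re (H $ i $ i)) \<le> Re (mexp H $ i $ i)" by (simp add: h_def)
  assume eq: "Re (mexp H $ i $ i) = exp (Re (H $ i $ i))" and ji: "j \<noteq> i"
  have "(\<Sum>p\<in>UNIV. ?c p * exp (q p) - ?c p * (exp h + exp h * (q p - h))) = 0"
    using eq E L by (simp add: sum_subtractf h_def)
  then have "?c p * exp (q p) - ?c p * (exp h + exp h * (q p - h)) = 0" for p
    using le by (subst (asm) sum_nonneg_eq_0_iff) auto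
  then have "V $ i $ p = 0 \<or> exp (q p) = exp h + exp h * (q p - h)" for p
    by (auto simp: right_diff_distrib[symmetric])
  then have V0: "V $ i $ p = 0 \<or> q p = h" for p using exp_tangent(2) by blast
  have "H $ j $ i = (\<Sum>p\<in>UNIV. V $ j $ p * complex_of_real (q p) * cnj (V $ i $ p))"
    by (simp add: Hq spectral_component)
  also have "\<dots> = (\<Sum>p\<in>UNIV. V $ j $ p * complex_of_real h * cnj (V $ i $ p))"
    using V0 by (intro sum.cong refl) auto
  also have "\<dots> = (V ** diagm (\<lambda>_. h) ** adj V) $ j $ i"
    by (simp add: spectral_component)
  also have "V ** diagm (\<lambda>_. h) ** adj V = h *\<^sub>R mat 1"
    using V spectral_scaleR[of h V "\<lambda>_. 1"] by (simp add: diagm_one unitary_def)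
  finally show "H $ j $ i = 0" using ji by (simp add: mat_def)
qed

text \<open>For norming weights y of exp(k) and the diagonal m of exp H, the chain sum y exp(k) <=
  sum y (exp(k) + exp(k) (h - k)) <= sum y exp(h) <= sum y m <= N(mexp H) closes up by
  \<open>le\<close>. Equality in the tangent bound gives h = k, and equality in Jensen's removes the
  off-diagonal entries.\<close>

theorem norm_mexp_rigidity:
  fixes N :: "'m::finite cmat \<Rightarrow> real"
  assumes N: "unitarily_invariant N" "strictly_increasing N" and H: "hermitian H"
    and kh: "ordered_majorized k (\<lambda>i. Re (H $ i $ i))"
    and le: "N (mexp H) \<le> N (diagm (\<lambda>i. exp (k i)))"
  shows "H = diagm k"
proof -
  define h where "h i = Re (H $ i $ i)" for i
  define m where "m i = Re (mexp H $ i $ i)" for i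
  obtain y where y: "\<And>x. (\<Sum>i\<in>UNIV. y i * x i) \<le> N (diagm x)"
    "(\<Sum>i\<in>UNIV. y i * exp (k i)) = N (diagm (\<lambda>i. exp (k i)))"
    "\<And>i. 0 < y i" "\<And>i j. exp (k i) < exp (k j) \<Longrightarrow> y i \<le> y j"
    using norming_weights[OF N, of "\<lambda>i. exp (k i)"] by auto
  have hm: "exp (h i) \<le> m i" for i unfolding h_def m_def by (rule mexp_diag(1)[OF H])
  have "(\<Sum>i\<in>UNIV. y i * m i) \<le> N (mexp H)"
    using y(1)[of m] norm_pinching[OF N(1) pd_hermitian[OF pd_mexp[OF H]]] by (simp add: m_def[abs_def])
  then have 1: "(\<Sum>i\<in>UNIV. y i * m i) \<le> (\<Sum>i\<in>UNIV. y i * exp (k i))" using le y(2) by simp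
  \<comment> \<open>The weights y_i exp(k_i) increase strictly with \<open>k\<close> even where y is
    constant.\<close>
  have "(\<Sum>i\<in>UNIV. (y i * exp (k i)) * k i) \<le> (\<Sum>i\<in>UNIV. (y i * exp (k i)) * h i)"
  proof (rule ordered_majorized_weighted)
    show "ordered_majorized k h" using kh by (simp add: h_def[abs_def])
    fix i j assume "k i < k j"
    then show "y i * exp (k i) < y j * exp (k j)"
      using y(3,4)[of i] y(3)[of j] y(4)[of i j] by (intro mult_le_less_imp_less) auto
  qed
  then have 2: "0 \<le> (\<Sum>i\<in>UNIV. y i * (exp (k i) * (h i - k i)))"
    by (simp add: right_diff_distrib sum_subtractf mult.assoc)
  \<comment> \<open>The two summands are the deficits at i in Jensen's inequality and in the tangent
    bound.\<close>
  define g where "g i = y i * (m i - exp (h i)) + y i * (exp (h i) - (exp (k i) + exp (k i) * (h i - k i)))" for i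
  have nn: "0 \<le> y i * (m i - exp (h i))" "0 \<le> y i * (exp (h i) - (exp (k i) + exp (k i) * (h i - k i)))" for i
    using y(3)[of i] hm[of i] exp_tangent(1)[of "k i" "h i"] by (auto intro!: mult_nonneg_nonneg)
  have "(\<Sum>i\<in>UNIV. g i) = (\<Sum>i\<in>UNIV. y i * m i) - (\<Sum>i\<in>UNIV. y i * exp (k i))
      - (\<Sum>i\<in>UNIV. y i * (exp (k i) * (h i - k i)))"
    by (simp add: g_def sum_subtractf[symmetric] algebra_simps)
  then have "(\<Sum>i\<in>UNIV. g i) \<le> 0" using 1 2 by linarith
  moreover have g0: "0 \<le> g i" for i using nn[of i] by (simp add: g_def)
  ultimately have "(\<Sum>i\<in>UNIV. g i) = 0" by (intro antisym sum_nonneg) auto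
  then have "g i = 0" for i using g0 by (simp add: sum_nonneg_eq_0_iff)
  then have "y i * (m i - exp (h i)) = 0 \<and> y i * (exp (h i) - (exp (k i) + exp (k i) * (h i - k i))) = 0" for i
    using nn[of i] unfolding g_def by (metis add_nonneg_eq_0_iff)
  then have mh: "m i = exp (h i)" and "exp (h i) = exp (k i) + exp (k i) * (h i - k i)" for i
    using y(3)[of i] by (metis less_irrefl mult_eq_0_iff eq_iff_diff_eq_0)+
  then have hk: "h i = k i" for i using exp_tangent(2) by blast
  show ?thesis
  proof -
    have "H $ j $ i = diagm k $ j $ i" for i j
    proof (cases "j = i")
      case True
      then show ?thesis using hermitian_diag_real[OF H, of i] hk[of i] by (simp add: diagm_component h_def)
    next
      case False
      then show ?thesis using mexp_diag(2)[OF H, of i j] mh[of i] by (simp add: diagm_component h_def m_def)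
    qed
    then show ?thesis by (simp add: vec_eq_iff)
  qed
qed

section \<open>Comparison of the two means\<close>

lemma LEmean_eq: "LEmean w n A = mexp (log_mean w n A)"
  by (simp add: LEmean_def log_mean_def cmat_scaleR)

lemma hermitian_log_mean: "(\<And>j. j < n \<Longrightarrow> pd (A j)) \<Longrightarrow> hermitian (log_mean w n A)"
  unfolding log_mean_def by (intro hermitian_sum hermitian_scaleR hermitian_mlog) auto

lemma log_mean_mpow:
  assumes "\<And>j. j < n \<Longrightarrow> pd (A j)"
  shows "log_mean w n (\<lambda>j. mpow (A j) t) = t *\<^sub>R log_mean w n A"
  using assms by (simp add: log_mean_def mlog_mpow scaleR_sum_right mult.commute)

lemma Karcher_solution:
  fixes A :: "nat \<Rightarrow> 'm::finite cmat"
  assumes A: "\<And>j. j < n \<Longrightarrow> pd (A j)" and w: "(\<Sum>j<n. w j) = 1" "\<And>j. j < n \<Longrightarrow> 0 < w j"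
  shows "pd (Karcher w n A) \<and> karcher_field w n (\<lambda>j. mpow (A j) (-1)) (Karcher w n A) = 0"
    and "pd X \<Longrightarrow> karcher_field w n (\<lambda>j. mpow (A j) (-1)) X = 0 \<Longrightarrow> Karcher w n A = X"
proof -
  let ?B = "\<lambda>j. mpow (A j) (-1)"
  have B: "\<And>j. j < n \<Longrightarrow> pd (?B j)" using A by (simp add: pd_mpow)
  have K: "Karcher w n A = (THE X. pd X \<and> karcher_field w n ?B X = 0)"
    by (simp add: Karcher_def karcher_field_def cmat_scaleR)
  have uniq: "Y = X" if "pd X" "karcher_field w n ?B X = 0" "pd Y" "karcher_field w n ?B Y = 0" for X Y
    using karcher_solution_unique[where B = ?B and w = w and n = n, OF B w that] .
  obtain X0 where X0: "pd X0" "karcher_field w n ?B X0 = 0"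
    using karcher_solution_exists[where B = ?B and w = w and n = n, OF B w] by blast
  show "pd (Karcher w n A) \<and> karcher_field w n ?B (Karcher w n A) = 0"
    unfolding K by (rule theI[of _ X0]) (use X0 uniq in blast)+
  show "Karcher w n A = X" if "pd X" "karcher_field w n ?B X = 0"
    unfolding K by (rule the_equality) (use that uniq in blast)+
qed

text \<open>The exponent \<open>s\<close> lets one statement serve both norm conditions: s = 1 for
  the means themselves, s = 1/t for the roots.\<close>

lemma karcher_norm_rigidity:
  fixes A :: "nat \<Rightarrow> 'm::finite cmat"
  assumes A: "\<And>j. j < n \<Longrightarrow> pd (A j)" and w: "(\<Sum>j<n. w j) = 1" "\<And>j. j < n \<Longrightarrow> 0 < w j"
    and N: "unitarily_invariant N" "strictly_increasing N" and s: "s \<noteq> 0"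
    and eq: "N (mpow (Karcher w n A) s) = N (mexp (s *\<^sub>R log_mean w n A))"
    and j: "j < n"
  shows "A j ** log_mean w n A = log_mean w n A ** A j"
proof -
  define X where "X = Karcher w n A"
  define H where "H = log_mean w n A"
  define B where "B j = mpow (A j) (-1)" for j
  have B: "\<And>j. j < n \<Longrightarrow> pd (B j)" using A by (simp add: B_def pd_mpow)
  have X: "pd X" "karcher_field w n B X = 0"
    using Karcher_solution(1)[where A = A and w = w and n = n, OF A w] by (simp_all add: X_def B_def[abs_def])
  have hH: "hermitian H" unfolding H_def by (rule hermitian_log_mean[OF A])
  have LB: "log_mean w n B = - H"
    using log_mean_mpow[where A = A and n = n and w = w and t = "-1", OF A] by (simp add: B_def[abs_def] H_def)
  obtain U k where U: "unitary U" and Xk: "X = U ** diagm (\<lambda>i. exp (k i)) ** adj U"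
    using pd_exp_spectral[OF X(1)] .
  note up = karcher_field_upset[where B = B and w = w and n = n, OF U Xk B w]
  define M where "M = adj U ** H ** U"
  have hM: "hermitian M" using hermitian_congruence[OF hH, of "adj U"] by (simp add: M_def)
  define h where "h i = Re (M $ i $ i)" for i
  \<comment> \<open>The field vanishes at the Karcher mean, and the log mean of the inverses is
    -H.\<close>
  have d: "Re ((adj U ** karcher_field w n B X ** U) $ i $ i) - Re ((adj U ** log_mean w n B ** U) $ i $ i) - k i
      = h i - k i" for i
  proof -
    have "adj U ** (- H) ** U = - M"
      unfolding M_def using cmult_scaleR_left[of "-1" "adj U ** H" U] cmult_scaleR_right[of "adj U" "-1" H] by simp
    then show ?thesis by (simp add: X(2) LB cmult_0_left cmult_0_right h_def)
  qed
  have "ordered_majorized k h"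
    using up(1,2) unfolding d ordered_majorized_def by (simp add: sum_subtractf)
  then have maj: "ordered_majorized (\<lambda>i. s * k i) (\<lambda>i. Re ((s *\<^sub>R M) $ i $ i))"
    using ordered_majorized_scale[of k h s] by (simp add: h_def[abs_def])
  have "N (mexp (s *\<^sub>R M)) = N (adj U ** mexp (s *\<^sub>R H) ** U)"
    using hfun_unitary_conj[OF U hermitian_scaleR[OF hH, of s], of exp]
    by (simp add: M_def mexp_def cmult_scaleR_left cmult_scaleR_right)
  also have "\<dots> = N (mpow X s)"
    using unitarily_invariantD(5)[OF N(1) unitary_adj[OF U] U] eq by (simp add: H_def X_def)
  also have "mpow X s = U ** diagm (\<lambda>i. exp (s * k i)) ** adj U"
    by (simp add: Xk mpow_def hfun_spectral[OF U] comp_def powr_def)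
  also have "N \<dots> = N (diagm (\<lambda>i. exp (s * k i)))"
    by (rule unitarily_invariantD(5)[OF N(1) U unitary_adj[OF U]])
  finally have "s *\<^sub>R M = diagm (\<lambda>i. s * k i)"
    by (intro norm_mexp_rigidity[OF N hermitian_scaleR[OF hM] maj]) simp
  then have "s *\<^sub>R M = s *\<^sub>R diagm k" by (simp add: diagm_scaleR)
  then have Mk: "M = diagm k" using s by simp
  then have Hk: "H = U ** diagm k ** adj U"
    using conj_spectral[OF U, of H] by (simp add: M_def)
  have hk: "h i - k i = 0" for i by (simp add: h_def Mk diagm_component)
  have "Re ((adj U ** karcher_field w n B X ** U) $ i $ i) - Re ((adj U ** log_mean w n B ** U) $ i $ i) - k i = 0" for i
    using d[of i] hk[of i] by (rule trans)
  from up(3)[OF _ _ this j] have "B j ** H = H ** B j" unfolding Hk by this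
  then have "mpow (B j) (-1) ** H = H ** mpow (B j) (-1)"
    unfolding mpow_def by (intro hfun_commute pd_hermitian B j)
  moreover have "mpow (B j) (-1) = A j"
    using A[OF j] by (simp add: B_def mpow_mpow mpow_one)
  ultimately show ?thesis by (simp add: H_def)
qed

lemma mlog_mexp_commuting:
  fixes P Q :: "'m::finite cmat"
  assumes "hermitian P" "hermitian Q" "P ** Q = Q ** P"
  shows "mlog (mexp P ** mexp Q ** mexp P) = P + Q + P"
proof -
  obtain U p q where U: "unitary U" and P: "P = U ** diagm p ** adj U" and Q: "Q = U ** diagm q ** adj U"
    using joint_spectral[OF assms] .
  have "mexp P ** mexp Q ** mexp P = U ** diagm (\<lambda>i. exp (p i + q i + p i)) ** adj U"
    by (simp only: P Q mexp_def hfun_spectral[OF U] spectral_mult[OF U] comp_def exp_add)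
  then have "mlog (mexp P ** mexp Q ** mexp P) = U ** diagm (\<lambda>i. p i + q i + p i) ** adj U"
    by (simp add: mlog_def hfun_spectral[OF U] comp_def)
  also have "\<dots> = P + Q + P"
    by (simp only: P Q spectral_add)
  finally show ?thesis .
qed

text \<open>Each term of the Karcher equation involves H and a single A_j, so commutation with H
  suffices to evaluate it as t H - t log A_j; the weighted terms then cancel.\<close>

lemma Karcher_commuting:
  fixes A :: "nat \<Rightarrow> 'm::finite cmat"
  assumes A: "\<And>j. j < n \<Longrightarrow> pd (A j)" and w: "(\<Sum>j<n. w j) = 1" "\<And>j. j < n \<Longrightarrow> 0 < w j"
    and comm: "\<And>j. j < n \<Longrightarrow> A j ** log_mean w n A = log_mean w n A ** A j"
  shows "Karcher w n (\<lambda>j. mpow (A j) t) = mexp (t *\<^sub>R log_mean w n A)"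
proof (rule Karcher_solution(2)[where w = w and n = n, OF _ w])
  define H where "H = log_mean w n A"
  have hH: "hermitian H" unfolding H_def by (rule hermitian_log_mean[OF A])
  show "pd (mpow (A j) t)" if "j < n" for j using A[OF that] by (rule pd_mpow)
  show "pd (mexp (t *\<^sub>R log_mean w n A))" using hH by (simp add: pd_mexp hermitian_scaleR H_def)
  have "mlog (mpow (mexp (t *\<^sub>R H)) (1/2) ** mpow (mpow (A j) t) (-1) ** mpow (mexp (t *\<^sub>R H)) (1/2))
      = t *\<^sub>R H - t *\<^sub>R mlog (A j)" if j: "j < n" for j
  proof -
    let ?P = "(t/2) *\<^sub>R H" and ?Q = "(-t) *\<^sub>R mlog (A j)"
    have 1: "mpow (mexp (t *\<^sub>R H)) (1/2) = mexp ?P"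
      using mpow_mexp[OF hermitian_scaleR[OF hH]] by simp
    have 2: "mpow (mpow (A j) t) (-1) = mexp ?Q"
      using A[OF j] by (subst mpow_mpow) (simp_all add: mpow_eq_mexp)
    have "mlog (A j) ** H = H ** mlog (A j)"
      unfolding mlog_def using comm[OF j] by (intro hfun_commute pd_hermitian A j) (simp add: H_def)
    then have "?P ** ?Q = ?Q ** ?P" by (simp only: cmult_scaleR_left cmult_scaleR_right scaleR_left_commute)
    then have "mlog (mexp ?P ** mexp ?Q ** mexp ?P) = ?P + ?Q + ?P"
      using hH A[OF j] by (intro mlog_mexp_commuting hermitian_scaleR hermitian_mlog)
    also have "\<dots> = (t/2 + t/2) *\<^sub>R H - t *\<^sub>R mlog (A j)"
      unfolding scaleR_left_distrib by simp
    finally show ?thesis unfolding 1 2 by simp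
  qed
  then have "karcher_field w n (\<lambda>j. mpow (mpow (A j) t) (-1)) (mexp (t *\<^sub>R H))
      = (\<Sum>j<n. w j *\<^sub>R (t *\<^sub>R H - t *\<^sub>R mlog (A j)))"
    unfolding karcher_field_def by (intro sum.cong) auto
  also have "\<dots> = (\<Sum>j<n. w j) *\<^sub>R (t *\<^sub>R H) - t *\<^sub>R H"
  proof -
    have "(\<Sum>j<n. w j *\<^sub>R t *\<^sub>R mlog (A j)) = t *\<^sub>R H"
      by (simp add: H_def log_mean_def scaleR_sum_right mult.commute)
    then show ?thesis
      by (simp only: scaleR_right_diff_distrib sum_subtractf scaleR_sum_left)
  qed
  finally show "karcher_field w n (\<lambda>j. mpow (mpow (A j) t) (-1)) (mexp (t *\<^sub>R log_mean w n A)) = 0"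
    using w by (simp add: H_def)
qed

theorem theorem5p4:
  fixes A :: "nat \<Rightarrow> complex^'m::finite^'m" and w :: "nat \<Rightarrow> real" and n :: nat
    and N :: "complex^'m^'m \<Rightarrow> real"
  assumes A: "\<And>j. j < n \<Longrightarrow> pd (A j)"
    and wpos: "\<And>j. j < n \<Longrightarrow> 0 < w j"
    and wsum: "(\<Sum>j<n. w j) = 1"
    and N: "unitarily_invariant N" "strictly_increasing N"
  shows "((\<forall>j<n. A j ** LEmean w n A = LEmean w n A ** A j)
           \<longleftrightarrow> (\<forall>t::real. Karcher w n (\<lambda>j. mpow (A j) t) = LEmean w n (\<lambda>j. mpow (A j) t)))
       \<and> ((\<forall>t::real. Karcher w n (\<lambda>j. mpow (A j) t) = LEmean w n (\<lambda>j. mpow (A j) t))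
           \<longleftrightarrow> (\<exists>t::real. t \<noteq> 0 \<and>
                 N (Karcher w n (\<lambda>j. mpow (A j) t)) = N (LEmean w n (\<lambda>j. mpow (A j) t))))
       \<and> ((\<exists>t::real. t \<noteq> 0 \<and>
                 N (Karcher w n (\<lambda>j. mpow (A j) t)) = N (LEmean w n (\<lambda>j. mpow (A j) t)))
           \<longleftrightarrow> (\<exists>t::real. t \<noteq> 0 \<and>
                 N (mpow (Karcher w n (\<lambda>j. mpow (A j) t)) (1/t)) = N (LEmean w n A)))"
    (is "(?a \<longleftrightarrow> ?b) \<and> (?b \<longleftrightarrow> ?c) \<and> (?c \<longleftrightarrow> ?d)")
proof -
  define H where "H = log_mean w n A"
  have hH: "hermitian H" unfolding H_def by (rule hermitian_log_mean[OF A])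
  have LE: "LEmean w n A = mexp H" by (simp add: LEmean_eq H_def)
  have LEt: "LEmean w n (\<lambda>j. mpow (A j) t) = mexp (t *\<^sub>R H)" for t
    using log_mean_mpow[where A = A and n = n and w = w, OF A] by (simp add: LEmean_eq H_def)
  have At: "pd (mpow (A j) t)" if "j < n" for j t using A[OF that] by (rule pd_mpow)
  have ab: ?b if ?a
  proof
    fix t
    have "A j ** H = H ** A j" if j: "j < n" for j
    proof -
      have "mexp H ** A j = A j ** mexp H" using \<open>?a\<close> j by (simp add: LE)
      then have "mlog (mexp H) ** A j = A j ** mlog (mexp H)"
        unfolding mlog_def by (intro hfun_commute pd_hermitian pd_mexp hH)
      then show ?thesis by (simp add: mlog_mexp hH)
    qed
    then show "Karcher w n (\<lambda>j. mpow (A j) t) = LEmean w n (\<lambda>j. mpow (A j) t)"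
      unfolding LEt H_def by (intro Karcher_commuting A wsum wpos)
  qed
  have bc: ?c if ?b using that by (intro exI[of _ 1]) simp
  have bd: ?d if ?b
    using that by (intro exI[of _ 1]) (simp add: LE LEt mpow_one pd_mexp hH)
  \<comment> \<open>Rigidity is applied to the family A_j^t, whose log mean is t H; commutation is
    carried back to A_j through the power 1/t.\<close>
  have key: ?a if t: "t \<noteq> 0" and s: "s \<noteq> 0"
    and eq: "N (mpow (Karcher w n (\<lambda>j. mpow (A j) t)) s) = N (mexp ((s * t) *\<^sub>R H))" for s t
  proof (intro allI impI)
    fix j assume j: "j < n"
    have lm: "log_mean w n (\<lambda>j. mpow (A j) t) = t *\<^sub>R H"
      unfolding H_def by (rule log_mean_mpow[OF A])
    have "mpow (A j) t ** (t *\<^sub>R H) = (t *\<^sub>R H) ** mpow (A j) t"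
      using karcher_norm_rigidity[where A = "\<lambda>j. mpow (A j) t" and w = w and n = n, OF At wsum wpos N s _ j] eq
      by (simp add: lm)
    then have "mpow (A j) t ** H = H ** mpow (A j) t"
      using t by (simp add: cmult_scaleR_left cmult_scaleR_right)
    then have "mpow (mpow (A j) t) (1/t) ** H = H ** mpow (mpow (A j) t) (1/t)"
      unfolding mpow_def[of _ "1/t"] by (intro hfun_commute pd_hermitian At j)
    then have "H ** A j = A j ** H" using A[OF j] t by (simp add: mpow_mpow mpow_one)
    then show "A j ** LEmean w n A = LEmean w n A ** A j"
      unfolding LE mexp_def by (intro hfun_commute[symmetric] hH)
  qed
  have ca: ?a if ?c
  proof -
    obtain t where t: "t \<noteq> 0" "N (Karcher w n (\<lambda>j. mpow (A j) t)) = N (LEmean w n (\<lambda>j. mpow (A j) t))"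
      using \<open>?c\<close> by blast
    have "pd (Karcher w n (\<lambda>j. mpow (A j) t))"
      using Karcher_solution(1)[where A = "\<lambda>j. mpow (A j) t" and w = w and n = n, OF At wsum wpos] by blast
    then show ?a using t by (intro key[of t 1]) (simp_all add: mpow_one LEt)
  qed
  have da: ?a if ?d
  proof -
    obtain t where t: "t \<noteq> 0" "N (mpow (Karcher w n (\<lambda>j. mpow (A j) t)) (1/t)) = N (LEmean w n A)"
      using \<open>?d\<close> by blast
    \<comment> \<open>With s = 1/t the product s t is 1, which gives the mean of the original family
      on the right.\<close>
    then show ?a by (intro key[of t "1/t"]) (simp_all add: LE)
  qed
  show ?thesis using ab bc bd ca da by blast
qed

end
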